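(* Assume that $M$ satisfies (SA) and $(\mathrm{DC}_L)$. Let $G$ be a group definable in $M$ that has no proper definable subgroups of finite index, and let $X_1,X_2,X_3$ be definable subsets of $G$ with $\delta(X_i)=\delta(G)=\delta_0$ for each $i$. Then (i) $X_1X_2X_3=G$, and (ii) $\delta(G\setminus X_1X_2)<\delta_0$.
   Context: Setting: $L$ is a countable first-order language and $\mathcal C$ an infinite class of finite $L$-structures. $L^+$ is the two-sorted language with a sort $\mathbf D$ carrying $L$, a sort $\mathbf{OF}$ with the ordered field language and $\log$, and for each $L$-formula $\phi(\bar x,\bar y)$ ($|\bar x|=r,|\bar y|=s$) a function symbol $f_\phi:\mathbf D^s\to\mathbf{OF}$ interpreted in each $N\in\mathcal C$ by $f_\phi(\bar a)=|\phi(N^r,\bar a)|$. $K^*$ is a non-principal ultraproduct, with $\mathbf{OF}$-sort $\mathbb R^*$; $M$ is the $L$-structure on the $\mathbf D$-sort. For definable $X=\phi(M^r,\bar a)$, $|X|=f_\phi(\bar a)$ and $\delta(X)=\log|X|+C\in\mathbb R^*/C$, $C$ the convex hull of $\mathbb Z$; for partial types $\delta(X)=\inf\{\delta(D):D\supseteq X\text{ definable}\}$ in the semigroup of cuts. (SA): for every partial type $p$ over a parameter set there is finite $p_0\subseteq p$ with $\delta(p)=\delta(p_0)$. $(\mathrm{DC}_L)$: for all $L$-formulas $\phi(\bar x,\bar y),\psi(\bar x,\bar z)$ there is an $L$-formula $\chi(\bar y,\bar z)$ with $M\models\chi(\bar a,\bar b)$ iff $\delta(\phi(\bar x,\bar a))\le\delta(\psi(\bar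 x,\bar b))$. $UV=\{uv:u\in U,v\in V\}$. *)

theory Defs
  imports Complex_Main "HOL-Library.NList" "HOL-Library.FuncSet"
    "HOL-Library.Countable_Set" "HOL-Algebra.Coset"
begin

section \<open>First-order logic\<close>

record ('f, 'p) language =
  fsyms :: "'f set"
  rsyms :: "'p set"
  farity :: "'f \<Rightarrow> nat"
  rarity :: "'p \<Rightarrow> nat"

definition countable_language :: "('f, 'p) language \<Rightarrow> bool" where
  "countable_language L \<longleftrightarrow> countable (fsyms L) \<and> countable (rsyms L)"

text \<open>Variables are de Bruijn indices into a list of values.\<close>

datatype 'f tm = Var nat | Fun 'f "'f tm list"

datatype ('f, 'p) fm =
    Equal "'f tm" "'f tm"
  | Rel 'p "'f tm list"
  | Neg "('f, 'p) fm"
  | Conj "('f, 'p) fm" "('f, 'p) fm"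
  | Exists "('f, 'p) fm"

text \<open>\<open>wf_fm L n \<phi>\<close>: \<open>\<phi>\<close> is an \<open>L\<close>-formula whose free variables are among the
  first \<open>n\<close> ones.\<close>

fun wf_tm :: "('f, 'p) language \<Rightarrow> nat \<Rightarrow> 'f tm \<Rightarrow> bool" where
  "wf_tm L n (Var i) \<longleftrightarrow> i < n"
| "wf_tm L n (Fun f ts) \<longleftrightarrow>
     f \<in> fsyms L \<and> length ts = farity L f \<and> (\<forall>t \<in> set ts. wf_tm L n t)"

fun wf_fm :: "('f, 'p) language \<Rightarrow> nat \<Rightarrow> ('f, 'p) fm \<Rightarrow> bool" where
  "wf_fm L n (Equal t u) \<longleftrightarrow> wf_tm L n t \<and> wf_tm L n u"
| "wf_fm L n (Rel p ts) \<longleftrightarrow>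
     p \<in> rsyms L \<and> length ts = rarity L p \<and> (\<forall>t \<in> set ts. wf_tm L n t)"
| "wf_fm L n (Neg \<phi>) \<longleftrightarrow> wf_fm L n \<phi>"
| "wf_fm L n (Conj \<phi> \<psi>) \<longleftrightarrow> wf_fm L n \<phi> \<and> wf_fm L n \<psi>"
| "wf_fm L n (Exists \<phi>) \<longleftrightarrow> wf_fm L (Suc n) \<phi>"

record ('f, 'p, 'a) struct =
  univ :: "'a set"
  fint :: "'f \<Rightarrow> 'a list \<Rightarrow> 'a"
  rint :: "'p \<Rightarrow> 'a list \<Rightarrow> bool"

definition is_structure :: "('f, 'p) language \<Rightarrow> ('f, 'p, 'a) struct \<Rightarrow> bool" where
  "is_structure L N \<longleftrightarrow> univ N \<noteq> {} \<and>
     (\<forall>f \<in> fsyms L. \<forall>xs \<in> nlists (farity L f) (univ N). fint N f xs \<in> univ N)"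

fun eval_tm :: "('f, 'p, 'a) struct \<Rightarrow> 'a list \<Rightarrow> 'f tm \<Rightarrow> 'a" where
  "eval_tm N e (Var i) = e ! i"
| "eval_tm N e (Fun f ts) = fint N f (map (eval_tm N e) ts)"

fun sat :: "('f, 'p, 'a) struct \<Rightarrow> 'a list \<Rightarrow> ('f, 'p) fm \<Rightarrow> bool" where
  "sat N e (Equal t u) \<longleftrightarrow> eval_tm N e t = eval_tm N e u"
| "sat N e (Rel p ts) \<longleftrightarrow> rint N p (map (eval_tm N e) ts)"
| "sat N e (Neg \<phi>) \<longleftrightarrow> \<not> sat N e \<phi>"
| "sat N e (Conj \<phi> \<psi>) \<longleftrightarrow> sat N e \<phi> \<and> sat N e \<psi>"
| "sat N e (Exists \<phi>) \<longleftrightarrow> (\<exists>a \<in> univ N. sat N (a # e) \<phi>)"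

text \<open>\<open>solset N r \<phi> as\<close> is \<open>\<phi>(N\<^sup>r, as)\<close>: in \<open>\<phi>(x, y)\<close> the object variables \<open>x\<close> are
  the indices below \<open>r\<close>, the parameter variables \<open>y\<close> come after them.\<close>

definition solset ::
  "('f, 'p, 'a) struct \<Rightarrow> nat \<Rightarrow> ('f, 'p) fm \<Rightarrow> 'a list \<Rightarrow> 'a list set" where
  "solset N r \<phi> as = {xs \<in> nlists r (univ N). sat N (xs @ as) \<phi>}"

definition definable ::
  "('f, 'p) language \<Rightarrow> ('f, 'p, 'a) struct \<Rightarrow> nat \<Rightarrow> 'a list set \<Rightarrow> bool" where
  "definable L N r X \<longleftrightarrow>
     (\<exists>\<phi> as. as \<in> lists (univ N) \<and> wf_fm L (r + length as) \<phi> \<and> X = solset N r \<phi> as)"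

section \<open>Ultraproducts\<close>

definition nonprincipal_ultrafilter_on :: "'i set \<Rightarrow> 'i filter \<Rightarrow> bool" where
  "nonprincipal_ultrafilter_on I U \<longleftrightarrow>
     U \<noteq> bot \<and> (\<forall>\<^sub>F i in U. i \<in> I) \<and>
     (\<forall>P. (\<forall>\<^sub>F i in U. P i) \<or> (\<forall>\<^sub>F i in U. \<not> P i)) \<and>
     (\<forall>j. \<not> (\<forall>\<^sub>F i in U. i = j))"

definition ultra_rel ::
  "'i set \<Rightarrow> 'i filter \<Rightarrow> ('i \<Rightarrow> 'b set) \<Rightarrow> (('i \<Rightarrow> 'b) \<times> ('i \<Rightarrow> 'b)) set" where
  "ultra_rel I U A = {(g, h). g \<in> Pi I A \<and> h \<in> Pi I A \<and> (\<forall>\<^sub>F i in U. g i = h i)}"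

definition ultra_carrier ::
  "'i set \<Rightarrow> 'i filter \<Rightarrow> ('i \<Rightarrow> 'b set) \<Rightarrow> ('i \<Rightarrow> 'b) set set" where
  "ultra_carrier I U A = Pi I A // ultra_rel I U A"

definition ultra_class ::
  "'i set \<Rightarrow> 'i filter \<Rightarrow> ('i \<Rightarrow> 'b set) \<Rightarrow> ('i \<Rightarrow> 'b) \<Rightarrow> ('i \<Rightarrow> 'b) set" where
  "ultra_class I U A g = ultra_rel I U A `` {g}"

definition rep :: "('i \<Rightarrow> 'b) set \<Rightarrow> 'i \<Rightarrow> 'b" where
  "rep c = (SOME g. g \<in> c)"

text \<open>A class of structures indexes its own ultraproduct.\<close>

type_synonym ('f, 'p, 'a) ultra_elem = "('f, 'p, 'a) struct \<Rightarrow> 'a"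

definition ultraproduct ::
  "('f, 'p, 'a) struct set \<Rightarrow> ('f, 'p, 'a) struct filter
     \<Rightarrow> ('f, 'p, ('f, 'p, 'a) ultra_elem set) struct" where
  "ultraproduct \<C> U =
     \<lparr> univ = ultra_carrier \<C> U univ,
       fint = (\<lambda>f cs. ultra_class \<C> U univ (\<lambda>N. fint N f (map (\<lambda>c. rep c N) cs))),
       rint = (\<lambda>p cs. \<forall>\<^sub>F N in U. rint N p (map (\<lambda>c. rep c N) cs)) \<rparr>"

text \<open>The other sort is the ultrapower \<open>\<real>\<^sup>*\<close> of the reals.\<close>

definition hreals :: "'i set \<Rightarrow> 'i filter \<Rightarrow> ('i \<Rightarrow> real) set set" where
  "hreals I U = ultra_carrier I U (\<lambda>_. UNIV)"

definition hclass :: "'i set \<Rightarrow> 'i filter \<Rightarrow> ('i \<Rightarrow> real) \<Rightarrow> ('i \<Rightarrow> real) set" where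
  "hclass I U = ultra_class I U (\<lambda>_. UNIV)"

definition hle :: "'i filter \<Rightarrow> ('i \<Rightarrow> real) set \<Rightarrow> ('i \<Rightarrow> real) set \<Rightarrow> bool" where
  "hle U x y \<longleftrightarrow> (\<forall>\<^sub>F i in U. rep x i \<le> rep y i)"

definition hdiff ::
  "'i set \<Rightarrow> 'i filter \<Rightarrow> ('i \<Rightarrow> real) set \<Rightarrow> ('i \<Rightarrow> real) set \<Rightarrow> ('i \<Rightarrow> real) set" where
  "hdiff I U x y = hclass I U (\<lambda>i. rep x i - rep y i)"

definition hlog :: "'i set \<Rightarrow> 'i filter \<Rightarrow> ('i \<Rightarrow> real) set \<Rightarrow> ('i \<Rightarrow> real) set" where
  "hlog I U x = hclass I U (\<lambda>i. ln (rep x i))"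

definition hint :: "'i set \<Rightarrow> 'i filter \<Rightarrow> int \<Rightarrow> ('i \<Rightarrow> real) set" where
  "hint I U k = hclass I U (\<lambda>_. of_int k)"

text \<open>The interpretation of the function symbol \<open>f\<^sub>\<phi>\<close> in the ultraproduct, where
  \<open>r\<close> is the number of object variables of \<open>\<phi>\<close>.\<close>

definition count_fun ::
  "('f, 'p, 'a) struct set \<Rightarrow> ('f, 'p, 'a) struct filter \<Rightarrow> nat \<Rightarrow> ('f, 'p) fm
     \<Rightarrow> ('f, 'p, 'a) ultra_elem set list \<Rightarrow> (('f, 'p, 'a) struct \<Rightarrow> real) set" where
  "count_fun \<C> U r \<phi> as =
     hclass \<C> U (\<lambda>N. real (card (solset N r \<phi> (map (\<lambda>c. rep c N) as))))"

section \<open>The pseudofinite dimension\<close>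

text \<open>The convex hull of the integers in \<open>\<real>\<^sup>*\<close>, the quotient by it, and its order.\<close>

definition conv_ints :: "'i set \<Rightarrow> 'i filter \<Rightarrow> ('i \<Rightarrow> real) set set" where
  "conv_ints I U = {x \<in> hreals I U. \<exists>k l. hle U (hint I U k) x \<and> hle U x (hint I U l)}"

definition hcoset :: "'i set \<Rightarrow> 'i filter \<Rightarrow> ('i \<Rightarrow> real) set \<Rightarrow> ('i \<Rightarrow> real) set set" where
  "hcoset I U x = {y \<in> hreals I U. hdiff I U y x \<in> conv_ints I U}"

definition hquot :: "'i set \<Rightarrow> 'i filter \<Rightarrow> ('i \<Rightarrow> real) set set set" where
  "hquot I U = hcoset I U ` hreals I U"

definition hquot_le ::
  "'i filter \<Rightarrow> ('i \<Rightarrow> real) set set \<Rightarrow> ('i \<Rightarrow> real) set set \<Rightarrow> bool" where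
  "hquot_le U A B \<longleftrightarrow> (\<exists>x \<in> A. \<exists>y \<in> B. hle U x y)"

text \<open>Cuts are downward closed subsets of \<open>\<real>\<^sup>*/C\<close>, so that their order is inclusion and
  their infimum is intersection; \<open>a \<in> \<real>\<^sup>*/C\<close> is identified with the cut of all
  elements \<open>\<le> a\<close>, and the empty cut is \<open>-\<infinity>\<close>.\<close>

type_synonym 'i hcut = "('i \<Rightarrow> real) set set set"

definition cut_of :: "'i set \<Rightarrow> 'i filter \<Rightarrow> ('i \<Rightarrow> real) set set \<Rightarrow> 'i hcut" where
  "cut_of I U a = {b \<in> hquot I U. hquot_le U b a}"

text \<open>The nonstandard cardinality of a definable set. The value \<open>f\<^sub>\<phi>(as)\<close> depends only on
  the set defined by \<open>\<phi>(x, as)\<close>.\<close>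

definition hcard ::
  "('f, 'p) language \<Rightarrow> ('f, 'p, 'a) struct set \<Rightarrow> ('f, 'p, 'a) struct filter
     \<Rightarrow> ('f, 'p, 'a) ultra_elem set list set \<Rightarrow> (('f, 'p, 'a) struct \<Rightarrow> real) set" where
  "hcard L \<C> U X = (THE c. \<exists>r \<phi> as.
     as \<in> lists (univ (ultraproduct \<C> U)) \<and> wf_fm L (r + length as) \<phi> \<and>
     X = solset (ultraproduct \<C> U) r \<phi> as \<and> c = count_fun \<C> U r \<phi> as)"

text \<open>\<open>log 0 = -\<infinity>\<close>, hence the special treatment of the empty set.\<close>

definition \<delta> ::
  "('f, 'p) language \<Rightarrow> ('f, 'p, 'a) struct set \<Rightarrow> ('f, 'p, 'a) struct filter
     \<Rightarrow> ('f, 'p, 'a) ultra_elem set list set \<Rightarrow> ('f, 'p, 'a) struct hcut" where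
  "\<delta> L \<C> U X =
     (if X = {} then {} else cut_of \<C> U (hcoset \<C> U (hlog \<C> U (hcard L \<C> U X))))"

section \<open>Partial types\<close>

text \<open>A formula with parameters is a pair \<open>(\<phi>, as)\<close>.\<close>

definition realizations ::
  "('f, 'p, 'a) struct \<Rightarrow> nat \<Rightarrow> (('f, 'p) fm \<times> 'a list) set \<Rightarrow> 'a list set" where
  "realizations M r p = {xs \<in> nlists r (univ M). \<forall>(\<phi>, as) \<in> p. sat M (xs @ as) \<phi>}"

definition partial_type ::
  "('f, 'p) language \<Rightarrow> ('f, 'p, 'a) struct \<Rightarrow> nat \<Rightarrow> 'a set
     \<Rightarrow> (('f, 'p) fm \<times> 'a list) set \<Rightarrow> bool" where
  "partial_type L M r B p \<longleftrightarrow>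
     (\<forall>(\<phi>, as) \<in> p. as \<in> lists B \<and> wf_fm L (r + length as) \<phi>) \<and>
     (\<forall>q. q \<subseteq> p \<and> finite q \<longrightarrow> realizations M r q \<noteq> {})"

text \<open>A definable set \<open>D\<close> contains a partial type if it does so in every elementary extension
  of \<open>M\<close>, that is, by compactness, if \<open>D\<close> contains the solution set of a finite part of the
  type. Inclusion of the realizations in \<open>M\<close> itself would not do: over an uncountable
  parameter set a partial type may have no realization in \<open>M\<close>.\<close>

definition type_in ::
  "('f, 'p, 'a) struct \<Rightarrow> nat \<Rightarrow> (('f, 'p) fm \<times> 'a list) set \<Rightarrow> 'a list set \<Rightarrow> bool" where
  "type_in M r p D \<longleftrightarrow> (\<exists>q. q \<subseteq> p \<and> finite q \<and> realizations M r q \<subseteq> D)"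

definition type_\<delta> ::
  "('f, 'p) language \<Rightarrow> ('f, 'p, 'a) struct set \<Rightarrow> ('f, 'p, 'a) struct filter \<Rightarrow> nat
     \<Rightarrow> (('f, 'p) fm \<times> ('f, 'p, 'a) ultra_elem set list) set \<Rightarrow> ('f, 'p, 'a) struct hcut" where
  "type_\<delta> L \<C> U r p =
     Inf {\<delta> L \<C> U D | D. definable L (ultraproduct \<C> U) r D \<and> type_in (ultraproduct \<C> U) r p D}"

definition strong_attainability ::
  "('f, 'p) language \<Rightarrow> ('f, 'p, 'a) struct set \<Rightarrow> ('f, 'p, 'a) struct filter \<Rightarrow> bool" where
  "strong_attainability L \<C> U \<longleftrightarrow>
     (\<forall>r B p. B \<subseteq> univ (ultraproduct \<C> U) \<and> partial_type L (ultraproduct \<C> U) r B p \<longrightarrow>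
        (\<exists>p\<^sub>0. p\<^sub>0 \<subseteq> p \<and> finite p\<^sub>0 \<and> type_\<delta> L \<C> U r p = type_\<delta> L \<C> U r p\<^sub>0))"

definition dimension_comparison ::
  "('f, 'p) language \<Rightarrow> ('f, 'p, 'a) struct set \<Rightarrow> ('f, 'p, 'a) struct filter \<Rightarrow> bool" where
  "dimension_comparison L \<C> U \<longleftrightarrow>
     (\<forall>r s t \<phi> \<psi>. wf_fm L (r + s) \<phi> \<and> wf_fm L (r + t) \<psi> \<longrightarrow>
        (\<exists>\<chi>. wf_fm L (s + t) \<chi> \<and>
           (\<forall>as \<in> nlists s (univ (ultraproduct \<C> U)). \<forall>bs \<in> nlists t (univ (ultraproduct \<C> U)).
              sat (ultraproduct \<C> U) (as @ bs) \<chi> \<longleftrightarrow>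
              \<delta> L \<C> U (solset (ultraproduct \<C> U) r \<phi> as)
                \<le> \<delta> L \<C> U (solset (ultraproduct \<C> U) r \<psi> bs))))"

section \<open>Definable groups\<close>

definition definable_group ::
  "('f, 'p) language \<Rightarrow> ('f, 'p, 'a) struct \<Rightarrow> nat \<Rightarrow> 'a list monoid \<Rightarrow> bool" where
  "definable_group L M n G \<longleftrightarrow>
     group G \<and> definable L M n (carrier G) \<and>
     definable L M (3 * n) {x @ y @ (x \<otimes>\<^bsub>G\<^esub> y) | x y. x \<in> carrier G \<and> y \<in> carrier G}"

end

theory Submission
  imports Defs
begin

text \<open>Write \<open>T\<close> for the set of all \<open>g\<close> for which \<open>X\<^sub>1 \<inter> g X\<^sub>2\<inverse>\<close> has dimension below \<open>\<delta>\<^sub>0\<close>, that is,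
  infinitesimal counting measure in \<open>G\<close>. It is definable by dimension comparison and contains
  \<open>G - X\<^sub>1 X\<^sub>2\<close>. A minimiser chosen in each finite structure shows that the sets
  \<open>X\<^sub>1 \<inter> g X\<^sub>2\<inverse>\<close> with \<open>g \<notin> T\<close> have measure bounded below by a standard \<open>\<epsilon>\<close>. Because of this gap,
  only boundedly many translates of \<open>T\<close> can be pairwise far apart in measure, so the subgroup
  of all \<open>h\<close> with \<open>T - h T\<close> null, which is again definable, has finite index and hence is all
  of \<open>G\<close>. Averaging over \<open>h\<close>, the measure of \<open>T\<close> is \<open>0\<close> or \<open>1\<close>; it is not \<open>1\<close>, since the average
  over \<open>g\<close> of the measure of \<open>X\<^sub>1 \<inter> g X\<^sub>2\<inverse>\<close> is the product of the measures of \<open>X\<^sub>1\<close> and \<open>X\<^sub>2\<close>.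
  This gives (ii), and (i) follows because \<open>g X\<^sub>3\<inverse>\<close> is not null and so meets \<open>X\<^sub>1 X\<^sub>2\<close>.\<close>

section \<open>Counting in finite groups\<close>

text \<open>The obstacle is that negligibility is an external notion: it quantifies over all
  standard \<epsilon> and cannot be evaluated in a single factor. Dimension comparison makes T and
  its stabilizer definable, so that they have slices in almost every finite structure, and pointwise
  estimates become uniform over slices: a ratio that is infinitesimal at each point of a definable
  set is below any prescribed standard \<eta> throughout its slices, and one that is nowhere
  infinitesimal stays above a common standard constant. For T and its complement this leaves a gap
  between \<eta> and 2\<epsilon>, where \<eta> can be chosen after \<epsilon>. The greedy argument
  spends this freedom: each of its J rounds costs \<eta> and gains \<epsilon>. All constants are
  standard and fixed before a factor is chosen, so every counting step takes place in one finite
  group, and no sum over the ultraproduct is ever formed. The dichotomy for the measure of T rests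
  on the identity that the sum over h of |T - hT| equals |T| |G - T|: if all summands are small, so
  is one of the two factors.\<close>

lemma sum_card_Collect_swap:
  assumes "finite A" "finite B"
  shows "(\<Sum>a\<in>A. card {b\<in>B. R a b}) = (\<Sum>b\<in>B. card {a\<in>A. R a b})"
  using sum.swap_restrict[OF assms, of "\<lambda>_ _. 1::nat" R] assms by simp

text \<open>As long as two indices \<open>h\<close>, \<open>h'\<close> are left, every \<open>g \<in> T h - T h'\<close> adds \<open>\<epsilon> n\<close> points to the
  union \<open>F\<close> of the sets \<open>D g\<close> chosen so far, because \<open>F\<close> almost misses \<open>A h'\<close>. By double
  counting, one such \<open>g\<close> lies in \<open>T h\<close> for a proportion \<open>\<epsilon>'\<close> of the remaining indices, which
  are kept. As \<open>F\<close> has at most \<open>n\<close> points, this stops before step \<open>J\<close>.\<close>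

lemma separated_family_bound:
  fixes n \<epsilon> \<epsilon>' \<eta> :: real and J :: nat
  assumes fin: "finite V" "finite W" "finite S"
    and n: "n > 0" "real (card V) \<le> n" "real (card W) \<le> n"
    and \<epsilon>': "0 < \<epsilon>'" "\<epsilon>' \<le> 1"
    and J: "real J * \<eta> \<le> \<epsilon>" "real J * \<epsilon> > 1" "0 \<le> \<eta>"
    and D: "\<And>g. g \<in> W \<Longrightarrow> D g \<subseteq> V"
    and T: "\<And>h. h \<in> S \<Longrightarrow> T h \<subseteq> W"
    and small: "\<And>h g. h \<in> S \<Longrightarrow> g \<in> T h \<Longrightarrow> real (card (D g \<inter> A h)) \<le> \<eta> * n"
    and large: "\<And>h g. h \<in> S \<Longrightarrow> g \<in> W - T h \<Longrightarrow> real (card (D g \<inter> A h)) \<ge> 2 * \<epsilon> * n"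
    and sep: "\<And>h h'. h \<in> S \<Longrightarrow> h' \<in> S \<Longrightarrow> h \<noteq> h' \<Longrightarrow> real (card (T h - T h')) \<ge> \<epsilon>' * n"
  shows "real (card S) * \<epsilon>' ^ J < 2"
proof (rule ccontr)
  assume "\<not> ?thesis"
  then have two: "real (card S) * \<epsilon>' ^ J \<ge> 2" by simp
  have "\<exists>S' F. S' \<subseteq> S \<and> F \<subseteq> V \<and> real (card S') \<ge> \<epsilon>' ^ j * real (card S)
      \<and> real (card F) \<ge> real j * \<epsilon> * n \<and> (\<forall>h\<in>S'. real (card (F \<inter> A h)) \<le> real j * \<eta> * n)"
    if "j \<le> J" for j
    using that
  proof (induction j)
    case 0
    show ?case by (rule exI[of _ S], rule exI[of _ "{}"]) auto
  next
    case (Suc j)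
    then obtain S' F where S': "S' \<subseteq> S" and F: "F \<subseteq> V"
      and cS': "real (card S') \<ge> \<epsilon>' ^ j * real (card S)"
      and cF: "real (card F) \<ge> real j * \<epsilon> * n"
      and FA: "\<And>h. h \<in> S' \<Longrightarrow> real (card (F \<inter> A h)) \<le> real j * \<eta> * n"
      by (metis Suc_leD)
    have finS': "finite S'" and finF: "finite F"
      using S' F fin finite_subset by blast+
    \<comment> \<open>Since \<epsilon>' \<le> 1, at least two indices survive up to round J. So
      every survivor h has a partner h', and the next g is sought in T h - T h'.\<close>
    have "\<epsilon>' ^ J \<le> \<epsilon>' ^ j"
      using \<epsilon>' Suc.prems by (intro power_decreasing) auto
    then have "real (card S) * \<epsilon>' ^ J \<le> \<epsilon>' ^ j * real (card S)"
      by (subst mult.commute) (simp add: mult_right_mono)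
    then have cS2: "card S' \<ge> 2" using two cS' by linarith
    define E where "E = {g\<in>W. real (card (D g - F)) \<ge> \<epsilon> * n}"
    have finE: "finite E" unfolding E_def using fin by simp
    have ET: "real (card (E \<inter> T h)) \<ge> \<epsilon>' * n" if h: "h \<in> S'" for h
    proof -
      have "S' - {h} \<noteq> {}"
      proof
        assume "S' - {h} = {}"
        then have "S' \<subseteq> {h}" by blast
        then have "card S' \<le> 1" using card_mono[of "{h}" S'] by simp
        then show False using cS2 by simp
      qed
      then obtain h' where h': "h' \<in> S'" "h' \<noteq> h" by blast
      have "T h - T h' \<subseteq> E \<inter> T h"
      proof
        fix g assume g: "g \<in> T h - T h'"
        then have gW: "g \<in> W" using T h S' by blast
        \<comment> \<open>As g is not in T h', D g meets A h' in 2\<epsilon>n points, and F holds at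
          most J\<eta>n \<le> \<epsilon>n points of A h'. The factor 2 pays for this
          overlap.\<close>
        have "2 * \<epsilon> * n \<le> real (card (D g \<inter> A h'))"
          using large[of h' g] g gW h' S' by blast
        also have "\<dots> \<le> real (card ((D g - F) \<union> (F \<inter> A h')))"
          using finF finite_subset[OF D[OF gW] fin(1)] by (intro of_nat_mono card_mono) auto
        also have "\<dots> \<le> real (card (D g - F)) + real (card (F \<inter> A h'))"
          using card_Un_le by (metis of_nat_add of_nat_mono)
        also have "\<dots> \<le> real (card (D g - F)) + real j * \<eta> * n" using FA h' by simp
        also have "real j * \<eta> * n \<le> real J * \<eta> * n"
          using Suc.prems J n by (intro mult_right_mono) auto
        also have "\<dots> \<le> \<epsilon> * n" using J n by (intro mult_right_mono) auto
        finally show "g \<in> E \<inter> T h" using g gW unfolding E_def by auto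
      qed
      then have "card (T h - T h') \<le> card (E \<inter> T h)"
        using finE by (intro card_mono) auto
      then show ?thesis using sep[of h h'] h h' S' by fastforce
    qed
    have "\<exists>g\<in>E. real (card {h\<in>S'. g \<in> T h}) \<ge> \<epsilon>' * real (card S')"
    proof (rule ccontr)
      assume neg: "\<not> ?thesis"
      \<comment> \<open>The strict inequality between the sums below requires E to be
        nonempty.\<close>
      obtain h0 where "h0 \<in> S'" using cS2 by fastforce
      then have "real (card (E \<inter> T h0)) > 0" using ET \<epsilon>' n
        by (meson less_le_trans mult_pos_pos)
      then have Ene: "E \<noteq> {}" by auto
      have "real (card S') * (\<epsilon>' * n) \<le> (\<Sum>h\<in>S'. real (card (E \<inter> T h)))"
        using sum_bounded_below[of S' "\<epsilon>' * n" "\<lambda>h. real (card (E \<inter> T h))"] ET by simp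
      also have "\<dots> = real (\<Sum>h\<in>S'. card {g\<in>E. g \<in> T h})"
        by (simp add: Int_def)
      also have "\<dots> = (\<Sum>g\<in>E. real (card {h\<in>S'. g \<in> T h}))"
        using sum_card_Collect_swap[OF finS' finE, of "\<lambda>h g. g \<in> T h"] by simp
      also have "\<dots> < (\<Sum>g\<in>E. \<epsilon>' * real (card S'))"
        using neg Ene finE by (intro sum_strict_mono) auto
      also have "\<dots> = real (card E) * (\<epsilon>' * real (card S'))" by simp
      also have "\<dots> \<le> n * (\<epsilon>' * real (card S'))"
      proof -
        have "card E \<le> card W" unfolding E_def using fin by (intro card_mono) auto
        then show ?thesis using n \<epsilon>' by (intro mult_right_mono) auto
      qed
      finally show False by (simp add: mult_ac)
    qed
    then obtain g where g: "g \<in> E" "real (card {h\<in>S'. g \<in> T h}) \<ge> \<epsilon>' * real (card S')"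
      by blast
    have gW: "g \<in> W" using g E_def by simp
    have finD: "finite (D g)" using finite_subset[OF D[OF gW] fin(1)] .
    have "real (card (F \<union> D g)) = real (card F) + real (card (D g - F))"
      using card_Un_disjoint[of F "D g - F"] finF finD by (simp add: Un_Diff_cancel)
    then have cF': "real (card (F \<union> D g)) \<ge> real (Suc j) * \<epsilon> * n"
      using cF g E_def by (simp add: algebra_simps)
    have FA': "real (card ((F \<union> D g) \<inter> A h)) \<le> real (Suc j) * \<eta> * n"
      if "h \<in> {h\<in>S'. g \<in> T h}" for h
    proof -
      have "real (card ((F \<union> D g) \<inter> A h)) \<le> real (card (F \<inter> A h)) + real (card (D g \<inter> A h))"
        by (metis Int_Un_distrib2 card_Un_le of_nat_add of_nat_mono)
      also have "\<dots> \<le> real j * \<eta> * n + \<eta> * n"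
        using FA small that S' by (intro add_mono) auto
      finally show ?thesis by (simp add: algebra_simps)
    qed
    have "\<epsilon>' ^ Suc j * real (card S) \<le> \<epsilon>' * real (card S')"
      using mult_left_mono[OF cS', of \<epsilon>'] \<epsilon>' by (simp add: mult.assoc)
    then show ?case using g FA' cF' S' F D[OF gW]
      by (intro exI[of _ "{h\<in>S'. g \<in> T h}"] exI[of _ "F \<union> D g"]) auto
  qed
  from this[of J] obtain F where F: "F \<subseteq> V" "real (card F) \<ge> real J * \<epsilon> * n" by blast
  have "real (card F) \<le> n" using F n card_mono[OF fin(1) F(1)] by linarith
  moreover have "real J * \<epsilon> * n > 1 * n" using J n by (intro mult_strict_right_mono) auto
  ultimately show False using F by simp
qed

text \<open>This is P \<inter> g Q^-1; its cardinality counts the factorisations g = x y with x in P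
  and y in Q. It serves both for the group in the ultraproduct and for the finite groups in the
  factors.\<close>

definition factor_set :: "('b, 'c) monoid_scheme \<Rightarrow> 'b set \<Rightarrow> 'b set \<Rightarrow> 'b \<Rightarrow> 'b set" where
  "factor_set K P Q g = {x \<in> P. inv\<^bsub>K\<^esub> x \<otimes>\<^bsub>K\<^esub> g \<in> Q}"

text \<open>This is T - hT. One side of the symmetric difference measures how far T is from being
  invariant under h, because T and hT have the same size in a finite group.\<close>

definition shift_diff :: "('b, 'c) monoid_scheme \<Rightarrow> 'b set \<Rightarrow> 'b \<Rightarrow> 'b set" where
  "shift_diff K T h = {x \<in> T. inv\<^bsub>K\<^esub> h \<otimes>\<^bsub>K\<^esub> x \<notin> T}"

section \<open>Translates and factorisations in a finite group\<close>

context group begin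

lemma inv_mult_cancel1: "x \<in> carrier G \<Longrightarrow> y \<in> carrier G \<Longrightarrow> inv x \<otimes> (x \<otimes> y) = y"
  by (simp add: m_assoc[symmetric])

lemma inv_mult_cancel2: "x \<in> carrier G \<Longrightarrow> y \<in> carrier G \<Longrightarrow> x \<otimes> (inv x \<otimes> y) = y"
  by (simp add: m_assoc[symmetric])

lemma inv_mult_cancel3:
  assumes "h \<in> carrier G" "k \<in> carrier G" "x \<in> carrier G"
  shows "inv (inv h \<otimes> k) \<otimes> (inv h \<otimes> x) = inv k \<otimes> x"
  using assms by (simp add: inv_mult_group m_assoc inv_mult_cancel2)

lemma card_left_translate:
  assumes "h \<in> carrier G" "Q \<subseteq> carrier G"
  shows "card {x \<in> carrier G. inv h \<otimes> x \<in> Q} = card Q"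
proof -
  have "bij_betw (\<lambda>x. inv h \<otimes> x) {x \<in> carrier G. inv h \<otimes> x \<in> Q} Q"
    using assms by (intro bij_betw_byWitness[of _ "\<lambda>y. h \<otimes> y"])
      (auto simp: inv_mult_cancel1 inv_mult_cancel2 subset_iff)
  then show ?thesis by (rule bij_betw_same_card)
qed

text \<open>Here the translating element varies and the point is fixed, so the set is x Q^-1 rather
  than a translate of Q.\<close>

lemma card_inv_translate:
  assumes x: "x \<in> carrier G" and Q: "Q \<subseteq> carrier G"
  shows "card {h \<in> carrier G. inv h \<otimes> x \<in> Q} = card Q"
proof -
  have "bij_betw (\<lambda>h. inv h \<otimes> x) {h \<in> carrier G. inv h \<otimes> x \<in> Q} Q"
    using assms by (intro bij_betw_byWitness[of _ "\<lambda>y. x \<otimes> inv y"])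
      (auto simp: inv_mult_cancel1 inv_mult_cancel2 subset_iff inv_mult_group m_assoc)
  then show ?thesis by (rule bij_betw_same_card)
qed

text \<open>Double counting of pairs (x, g): a fixed x in P lies in the factor set of g exactly when
  g is in x Q.\<close>

lemma sum_card_factor_set:
  assumes fin: "finite (carrier G)" and P: "P \<subseteq> carrier G" and Q: "Q \<subseteq> carrier G"
  shows "(\<Sum>g\<in>carrier G. card (factor_set G P Q g)) = card P * card Q"
proof -
  have "(\<Sum>g\<in>carrier G. card (factor_set G P Q g))
      = (\<Sum>x\<in>P. card {g\<in>carrier G. inv x \<otimes> g \<in> Q})"
    unfolding factor_set_def using fin finite_subset[OF P fin] by (rule sum_card_Collect_swap)
  also have "\<dots> = (\<Sum>x\<in>P. card Q)"
    using card_left_translate[OF _ Q] P by (intro sum.cong) auto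
  finally show ?thesis by simp
qed

text \<open>A fixed x in T lies outside hT exactly for h in x (G - T)^-1, hence for |G - T| values
  of h.\<close>

lemma sum_card_shift_diff:
  assumes fin: "finite (carrier G)" and T: "T \<subseteq> carrier G"
  shows "(\<Sum>h\<in>carrier G. card (shift_diff G T h)) = card T * card (carrier G - T)"
proof -
  have "(\<Sum>h\<in>carrier G. card (shift_diff G T h))
      = (\<Sum>x\<in>T. card {h\<in>carrier G. inv h \<otimes> x \<notin> T})"
    unfolding shift_diff_def using fin finite_subset[OF T fin] by (rule sum_card_Collect_swap)
  also have "\<dots> = (\<Sum>x\<in>T. card {h\<in>carrier G. inv h \<otimes> x \<in> carrier G - T})"
    using T by (intro sum.cong refl arg_cong[of _ _ card]) auto
  also have "\<dots> = (\<Sum>x\<in>T. card (carrier G - T))"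
    using T by (intro sum.cong card_inv_translate) auto
  finally show ?thesis by simp
qed

text \<open>Left translation by h carries T - h^-1 k T onto hT - kT, so the distance between two
  translates depends only on h^-1 k.\<close>

lemma card_translate_diff:
  assumes T: "T \<subseteq> carrier G" and h: "h \<in> carrier G" and k: "k \<in> carrier G"
  shows "card ({x \<in> carrier G. inv h \<otimes> x \<in> T} - {x \<in> carrier G. inv k \<otimes> x \<in> T})
    = card (shift_diff G T (inv h \<otimes> k))"
proof -
  have "{x \<in> carrier G. inv h \<otimes> x \<in> T} - {x \<in> carrier G. inv k \<otimes> x \<in> T}
     = {x \<in> carrier G. inv h \<otimes> x \<in> shift_diff G T (inv h \<otimes> k)}"
    unfolding shift_diff_def using inv_mult_cancel3[OF h k] by auto
  moreover have "shift_diff G T (inv h \<otimes> k) \<subseteq> carrier G" unfolding shift_diff_def using T by auto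
  ultimately show ?thesis using card_left_translate[OF h] by simp
qed

text \<open>T and hT have equal size, hence so do hT - T and T - hT, and the former is the translate
  by h of T - h^-1 T.\<close>

lemma card_shift_diff_inv:
  assumes fin: "finite (carrier G)" and T: "T \<subseteq> carrier G" and h: "h \<in> carrier G"
  shows "card (shift_diff G T (inv h)) = card (shift_diff G T h)"
proof -
  let ?hT = "{x \<in> carrier G. inv h \<otimes> x \<in> T}"
  have "card (?hT - T) = card (T - ?hT)"
  proof -
    have "card (?hT - T) = card ?hT - card (?hT \<inter> T)"
      using fin by (intro card_Diff_subset_Int) auto
    moreover have "card (T - ?hT) = card T - card (T \<inter> ?hT)"
      using fin by (intro card_Diff_subset_Int) auto
    ultimately show ?thesis using card_left_translate[OF h T] by (simp add: Int_commute)
  qed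
  moreover have "?hT - T = ?hT - {x \<in> carrier G. inv \<one> \<otimes> x \<in> T}"
    using T by auto
  moreover have "T - ?hT = shift_diff G T h" unfolding shift_diff_def using T h by auto
  ultimately show ?thesis using card_translate_diff[OF T h one_closed] h by simp
qed

text \<open>A triangle inequality: T - hkT \<subseteq> (T - hT) \<union> h(T - kT).\<close>

lemma card_shift_diff_mult:
  assumes fin: "finite (carrier G)" and T: "T \<subseteq> carrier G"
    and h: "h \<in> carrier G" and k: "k \<in> carrier G"
  shows "card (shift_diff G T (h \<otimes> k)) \<le> card (shift_diff G T h) + card (shift_diff G T k)"
proof -
  let ?S = "{x \<in> carrier G. inv h \<otimes> x \<in> shift_diff G T k}"
  have "shift_diff G T (h \<otimes> k) \<subseteq> shift_diff G T h \<union> ?S"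
  proof
    fix x assume x: "x \<in> shift_diff G T (h \<otimes> k)"
    then have xG: "x \<in> carrier G" using T unfolding shift_diff_def by auto
    have "inv (h \<otimes> k) \<otimes> x = inv k \<otimes> (inv h \<otimes> x)"
      using h k xG by (simp add: inv_mult_group m_assoc)
    then show "x \<in> shift_diff G T h \<union> ?S" using x xG unfolding shift_diff_def by auto
  qed
  then have "card (shift_diff G T (h \<otimes> k)) \<le> card (shift_diff G T h \<union> ?S)"
    using fin finite_subset[OF T fin] by (intro card_mono) (auto simp: shift_diff_def)
  also have "\<dots> \<le> card (shift_diff G T h) + card ?S" by (rule card_Un_le)
  also have "card ?S = card (shift_diff G T k)"
    using T by (intro card_left_translate[OF h]) (auto simp: shift_diff_def)
  finally show ?thesis .
qed

text \<open>The combinatorial bound is applied to the families g Q^-1, h P and h T. The intersection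
  of g Q^-1 and h P is the translate by h of the factor set of h^-1 g, so estimates on T and off T
  become estimates on each hT and off it.\<close>

lemma shift_separated_bound:
  fixes \<epsilon> \<epsilon>' \<eta> :: real
  assumes fin: "finite (carrier G)" and sub: "P \<subseteq> carrier G" "Q \<subseteq> carrier G" "T \<subseteq> carrier G" "S \<subseteq> carrier G"
    and \<epsilon>': "0 < \<epsilon>'" "\<epsilon>' \<le> 1"
    and J: "real J * \<eta> \<le> \<epsilon>" "real J * \<epsilon> > 1" "0 \<le> \<eta>"
    and small: "\<And>g. g \<in> T \<Longrightarrow> real (card (factor_set G P Q g)) \<le> \<eta> * real (card (carrier G))"
    and large: "\<And>g. g \<in> carrier G - T \<Longrightarrow>
      real (card (factor_set G P Q g)) \<ge> 2 * \<epsilon> * real (card (carrier G))"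
    and sep: "\<And>h k. h \<in> S \<Longrightarrow> k \<in> S \<Longrightarrow> h \<noteq> k \<Longrightarrow>
      real (card (shift_diff G T (inv h \<otimes> k))) \<ge> \<epsilon>' * real (card (carrier G))"
  shows "real (card S) * \<epsilon>' ^ J < 2"
proof -
  let ?n = "real (card (carrier G))"
  define D where "D g = {x \<in> carrier G. inv x \<otimes> g \<in> Q}" for g
  define A where "A h = {x \<in> carrier G. inv h \<otimes> x \<in> P}" for h
  define T' where "T' h = {x \<in> carrier G. inv h \<otimes> x \<in> T}" for h
  have DA: "card (D g \<inter> A h) = card (factor_set G P Q (inv h \<otimes> g))"
    if "g \<in> carrier G" "h \<in> carrier G" for g h
  proof -
    have "D g \<inter> A h = {x \<in> carrier G. inv h \<otimes> x \<in> factor_set G P Q (inv h \<otimes> g)}"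
      unfolding D_def A_def factor_set_def
      using that inv_mult_cancel3 by auto
    moreover have "factor_set G P Q (inv h \<otimes> g) \<subseteq> carrier G"
      unfolding factor_set_def using sub by auto
    ultimately show ?thesis using card_left_translate that by simp
  qed
  have n0: "?n > 0" using fin one_closed by (auto simp: card_gt_0_iff)
  show ?thesis
  proof (rule separated_family_bound[where V = "carrier G" and W = "carrier G" and n = ?n
        and D = D and A = A and T = T', OF fin fin finite_subset[OF sub(4) fin] n0 order.refl order.refl \<epsilon>' J])
    show "real (card (D g \<inter> A h)) \<le> \<eta> * ?n" if "h \<in> S" "g \<in> T' h" for h g
      using that small DA sub(4) unfolding T'_def by auto
    show "real (card (D g \<inter> A h)) \<ge> 2 * \<epsilon> * ?n" if "h \<in> S" "g \<in> carrier G - T' h" for h g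
      using that large[of "inv h \<otimes> g"] DA[of g h] sub(4) unfolding T'_def by auto
    show "real (card (T' h - T' k)) \<ge> \<epsilon>' * ?n" if "h \<in> S" "k \<in> S" "h \<noteq> k" for h k
      using sep[OF that] card_translate_diff[OF sub(3), of h k] that sub(4) unfolding T'_def
      by (simp add: subset_iff)
  qed (auto simp: D_def T'_def)
qed

end

section \<open>Definable sets\<close>

fun rename_tm :: "(nat \<Rightarrow> nat) \<Rightarrow> 'f tm \<Rightarrow> 'f tm" where
  "rename_tm f (Var i) = Var (f i)"
| "rename_tm f (Fun g ts) = Fun g (map (rename_tm f) ts)"

definition lift_map :: "(nat \<Rightarrow> nat) \<Rightarrow> nat \<Rightarrow> nat" where
  "lift_map f = case_nat 0 (\<lambda>i. Suc (f i))"

fun rename_fm :: "(nat \<Rightarrow> nat) \<Rightarrow> ('f, 'p) fm \<Rightarrow> ('f, 'p) fm" where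
  "rename_fm f (Equal t u) = Equal (rename_tm f t) (rename_tm f u)"
| "rename_fm f (Rel p ts) = Rel p (map (rename_tm f) ts)"
| "rename_fm f (Neg \<phi>) = Neg (rename_fm f \<phi>)"
| "rename_fm f (Conj \<phi> \<psi>) = Conj (rename_fm f \<phi>) (rename_fm f \<psi>)"
| "rename_fm f (Exists \<phi>) = Exists (rename_fm (lift_map f) \<phi>)"

lemma wf_rename_tm:
  assumes "wf_tm L m t" "\<And>i. i < m \<Longrightarrow> f i < k"
  shows "wf_tm L k (rename_tm f t)"
  using assms by (induction t) auto

lemma wf_rename_fm:
  assumes "wf_fm L m \<phi>" "\<And>i. i < m \<Longrightarrow> f i < k"
  shows "wf_fm L k (rename_fm f \<phi>)"
  using assms
proof (induction \<phi> arbitrary: m k f)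
  case (Exists \<phi>)
  have "wf_fm L (Suc k) (rename_fm (lift_map f) \<phi>)"
    using Exists.prems by (intro Exists.IH[of "Suc m"]) (auto simp: lift_map_def split: nat.split)
  then show ?case by simp
qed (auto intro: wf_rename_tm)

lemma eval_rename_tm:
  assumes "wf_tm L m t" "\<And>i. i < m \<Longrightarrow> e' ! i = e ! f i"
  shows "eval_tm N e (rename_tm f t) = eval_tm N e' t"
  using assms
proof (induction t)
  case (Fun g ts)
  then have "map (eval_tm N e \<circ> rename_tm f) ts = map (eval_tm N e') ts" by auto
  then show ?case by (metis eval_tm.simps(2) map_map rename_tm.simps(2))
qed auto

lemma sat_rename_fm:
  assumes "wf_fm L m \<phi>" "\<And>i. i < m \<Longrightarrow> e' ! i = e ! f i"
  shows "sat N e (rename_fm f \<phi>) \<longleftrightarrow> sat N e' \<phi>"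
  using assms
proof (induction \<phi> arbitrary: m e e' f)
  case (Rel p ts)
  then have "map (eval_tm N e \<circ> rename_tm f) ts = map (eval_tm N e') ts"
    by (auto intro!: eval_rename_tm)
  then show ?case by (simp del: map_eq_conv)
next
  case (Exists \<phi>)
  have "sat N (a # e) (rename_fm (lift_map f) \<phi>) \<longleftrightarrow> sat N (a # e') \<phi>" for a
    using Exists.prems
    by (intro Exists.IH[of "Suc m"]) (auto simp: lift_map_def nth_Cons split: nat.split)
  then show ?case by simp
next
  case (Equal t u)
  then show ?case using eval_rename_tm[of L m t e' e f N] eval_rename_tm[of L m u e' e f N] by auto
next
  case (Conj \<phi> \<psi>)
  then show ?case using Conj.IH[of m e' e f] by simp
next
  case (Neg \<phi>)
  then show ?case using Neg.IH[of m e' e f] by simp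
qed

lemma wf_Exists_funpow: "wf_fm L m ((Exists ^^ r) \<phi>) \<longleftrightarrow> wf_fm L (r + m) \<phi>"
  by (induction r arbitrary: \<phi>) (simp_all add: funpow_swap1 del: funpow.simps add: funpow_Suc_right)

lemma sat_Exists_funpow:
  "sat N e ((Exists ^^ r) \<phi>) \<longleftrightarrow> (\<exists>xs\<in>nlists r (univ N). sat N (xs @ e) \<phi>)"
proof (induction r arbitrary: \<phi>)
  case (Suc r)
  \<comment> \<open>The innermost quantifier is peeled off: environments grow at the front, so its
    value is the head of the block.\<close>
  have "sat N e ((Exists ^^ Suc r) \<phi>) \<longleftrightarrow> (\<exists>xs\<in>nlists r (univ N). \<exists>a\<in>univ N. sat N ((a # xs) @ e) \<phi>)"
    using Suc by (simp add: funpow_Suc_right del: funpow.simps)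
  also have "\<dots> \<longleftrightarrow> (\<exists>xs\<in>nlists (Suc r) (univ N). sat N (xs @ e) \<phi>)"
    by (auto simp: nlists_Suc)
  finally show ?case .
qed auto

section \<open>Closure properties of definable sets\<close>

lemma definable_subset: "definable L M r X \<Longrightarrow> X \<subseteq> nlists r (univ M)"
  unfolding definable_def solset_def by auto

text \<open>Permuting, selecting and padding coordinates are all instances: \<open>f\<close> is an
  arbitrary map of indices within the given bounds.\<close>

lemma definable_preimage:
  assumes X: "definable L M r X" and f: "\<And>i. i < r \<Longrightarrow> f i < s"
  shows "definable L M s {xs \<in> nlists s (univ M). map (\<lambda>i. xs ! f i) [0..<r] \<in> X}"
proof -
  obtain \<phi> as where as: "as \<in> lists (univ M)" and wf: "wf_fm L (r + length as) \<phi>"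
    and X: "X = solset M r \<phi> as"
    using X unfolding definable_def by blast
  \<comment> \<open>The parameters sit behind the object variables, so they move from position
    \<open>r\<close> to position \<open>s\<close>.\<close>
  define f' where "f' i = (if i < r then f i else s + (i - r))" for i
  have "{xs \<in> nlists s (univ M). map (\<lambda>i. xs ! f i) [0..<r] \<in> X} = solset M s (rename_fm f' \<phi>) as"
  proof -
    have "map (\<lambda>i. xs ! f i) [0..<r] \<in> X \<longleftrightarrow> sat M (xs @ as) (rename_fm f' \<phi>)"
      if xs: "xs \<in> nlists s (univ M)" for xs
    proof -
      have "sat M (xs @ as) (rename_fm f' \<phi>) \<longleftrightarrow> sat M (map (\<lambda>i. xs ! f i) [0..<r] @ as) \<phi>"
        using wf f nlistsE_length[OF xs]
        by (intro sat_rename_fm) (auto simp: f'_def nth_append)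
      moreover have "map (\<lambda>i. xs ! f i) [0..<r] \<in> nlists r (univ M)"
        using xs f by (intro nlistsI) (auto intro: nlistsE_nth_in)
      ultimately show ?thesis unfolding X solset_def by simp
    qed
    then show ?thesis unfolding solset_def by auto
  qed
  moreover have "wf_fm L (s + length as) (rename_fm f' \<phi>)"
    using f by (intro wf_rename_fm[OF wf]) (force simp: f'_def)
  ultimately show ?thesis using as unfolding definable_def by blast
qed

lemma definable_Compl:
  assumes "definable L M r X"
  shows "definable L M r (nlists r (univ M) - X)"
proof -
  obtain \<phi> as where as: "as \<in> lists (univ M)" and wf: "wf_fm L (r + length as) \<phi>"
    and X: "X = solset M r \<phi> as"
    using assms unfolding definable_def by blast
  have "nlists r (univ M) - X = solset M r (Neg \<phi>) as" unfolding X solset_def by auto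
  moreover have "wf_fm L (r + length as) (Neg \<phi>)" using wf by simp
  ultimately show ?thesis using as unfolding definable_def by blast
qed

lemma definable_Int:
  assumes "definable L M r X" "definable L M r Y"
  shows "definable L M r (X \<inter> Y)"
proof -
  obtain \<phi> as where as: "as \<in> lists (univ M)" and wf: "wf_fm L (r + length as) \<phi>"
    and X: "X = solset M r \<phi> as"
    using assms(1) unfolding definable_def by blast
  obtain \<psi> bs where bs: "bs \<in> lists (univ M)" and wf': "wf_fm L (r + length bs) \<psi>"
    and Y: "Y = solset M r \<psi> bs"
    using assms(2) unfolding definable_def by blast
  \<comment> \<open>The parameters of \<psi> now stand behind those of \<phi>.\<close>
  define f where "f i = (if i < r then i else i + length as)" for i
  let ?\<chi> = "Conj (rename_fm id \<phi>) (rename_fm f \<psi>)"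
  have "sat M (xs @ as @ bs) ?\<chi> \<longleftrightarrow> sat M (xs @ as) \<phi> \<and> sat M (xs @ bs) \<psi>"
    if "xs \<in> nlists r (univ M)" for xs
  proof -
    have "sat M (xs @ as @ bs) (rename_fm id \<phi>) \<longleftrightarrow> sat M (xs @ as) \<phi>"
      using that by (intro sat_rename_fm[OF wf]) (auto simp: nth_append)
    moreover have "sat M (xs @ as @ bs) (rename_fm f \<psi>) \<longleftrightarrow> sat M (xs @ bs) \<psi>"
      using that by (intro sat_rename_fm[OF wf']) (auto simp: f_def nth_append)
    ultimately show ?thesis by simp
  qed
  then have "X \<inter> Y = solset M r ?\<chi> (as @ bs)" unfolding X Y solset_def by auto
  moreover have "wf_fm L (r + length (as @ bs)) ?\<chi>"
    by (auto intro!: wf_rename_fm[OF wf] wf_rename_fm[OF wf'] simp: f_def)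
  moreover have "as @ bs \<in> lists (univ M)" using as bs by simp
  ultimately show ?thesis unfolding definable_def by blast
qed

lemma definable_Diff:
  assumes "definable L M r X" "definable L M r Y"
  shows "definable L M r (X - Y)"
proof -
  have "X - Y = X \<inter> (nlists r (univ M) - Y)" using definable_subset[OF assms(1)] by auto
  then show ?thesis using definable_Int[OF assms(1) definable_Compl[OF assms(2)]] by simp
qed

text \<open>Quantifiers bind at the front of the environment, so the eliminated block has to be the
  first one.\<close>

lemma definable_projection:
  assumes "definable L M (r + s) X"
  shows "definable L M s {ys \<in> nlists s (univ M). \<exists>xs\<in>nlists r (univ M). xs @ ys \<in> X}"
proof -
  obtain \<phi> as where as: "as \<in> lists (univ M)" and wf: "wf_fm L (r + s + length as) \<phi>"
    and X: "X = solset M (r + s) \<phi> as"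
    using assms unfolding definable_def by blast
  have "{ys \<in> nlists s (univ M). \<exists>xs\<in>nlists r (univ M). xs @ ys \<in> X}
      = solset M s ((Exists ^^ r) \<phi>) as"
    unfolding X solset_def by (auto simp: sat_Exists_funpow intro: nlists_appendI)
  moreover have "wf_fm L (s + length as) ((Exists ^^ r) \<phi>)"
    using wf by (simp add: wf_Exists_funpow add.assoc)
  ultimately show ?thesis using as unfolding definable_def by blast
qed

lemma definable_block:
  assumes "definable L M n X" "k + n \<le> s"
  shows "definable L M s {zs \<in> nlists s (univ M). take n (drop k zs) \<in> X}"
proof -
  have "map (\<lambda>i. zs ! (k + i)) [0..<n] = take n (drop k zs)" if "zs \<in> nlists s (univ M)" for zs
    using that assms(2) by (intro nth_equalityI) auto
  then show ?thesis using definable_preimage[OF assms(1), of "\<lambda>i. k + i" s] assms(2)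
    by (simp cong: conj_cong)
qed

lemma definable_blocks3:
  assumes "definable L M (3 * n) X" "a + n \<le> s" "b + n \<le> s" "c + n \<le> s"
  shows "definable L M s {zs \<in> nlists s (univ M).
    take n (drop a zs) @ take n (drop b zs) @ take n (drop c zs) \<in> X}"
proof -
  define f where "f i = (if i < n then a + i else if i < n + n then b + (i - n) else c + (i - (n + n)))" for i
  have "map (\<lambda>i. zs ! f i) [0..<3 * n] = take n (drop a zs) @ take n (drop b zs) @ take n (drop c zs)"
    if "zs \<in> nlists s (univ M)" for zs
    using that assms(2-) by (intro nth_equalityI) (auto simp: f_def nth_append)
  moreover have "definable L M s {zs \<in> nlists s (univ M). map (\<lambda>i. zs ! f i) [0..<3 * n] \<in> X}"
    using assms by (intro definable_preimage) (auto simp: f_def)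
  ultimately show ?thesis by (simp cong: conj_cong)
qed

text \<open>The group law is available only through its graph, so x^-1 z \<in> Q is expressed,
  without inverses, by the existence of y in Q with x y = z. When \<open>\<Gamma>\<close> is the
  graph, the fibre of the first relation over g is the factor set of g. When moreover Q is the
  complement of P in the group, the fibre of the second over h is P - hP.\<close>

lemma definable_factor_relation:
  assumes \<Gamma>: "definable L M (3 * n) \<Gamma>" and P: "definable L M n P" and Q: "definable L M n Q"
  shows "definable L M (n + n) {x @ z | x z. x \<in> P \<and> z \<in> nlists n (univ M) \<and> (\<exists>y\<in>Q. x @ y @ z \<in> \<Gamma>)}"
    and "definable L M (n + n) {x @ z | x z. x \<in> P \<and> z \<in> nlists n (univ M) \<and> (\<exists>y\<in>Q. z @ y @ x \<in> \<Gamma>)}"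
proof -
  let ?V = "nlists (n + (n + n)) (univ M)"
  \<comment> \<open>The blocks are ordered y, x, z because projection removes the first one.\<close>
  let ?PQ = "{w \<in> ?V. take n (drop 0 w) \<in> Q} \<inter> {w \<in> ?V. take n (drop n w) \<in> P}"
  have PQ: "definable L M (n + (n + n)) ?PQ"
    by (rule definable_Int[OF definable_block[OF Q] definable_block[OF P]]) simp_all
  have sub: "P \<subseteq> nlists n (univ M)" "Q \<subseteq> nlists n (univ M)"
    using definable_subset[OF P] definable_subset[OF Q] by simp_all
  have split: "\<exists>x z. w = x @ z \<and> x \<in> nlists n (univ M) \<and> z \<in> nlists n (univ M)"
    if "w \<in> nlists (n + n) (univ M)" for w
  proof (intro exI conjI)
    show "w = take n w @ drop n w" by simp
    show "take n w \<in> nlists n (univ M)" "drop n w \<in> nlists n (univ M)"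
      using that set_take_subset[of n w] set_drop_subset[of n w] by (auto simp: nlists_def simp del: nlistsE_length nlistsE_set)
  qed
  have V: "y @ x @ z \<in> ?V"
    if "x \<in> nlists n (univ M)" "y \<in> nlists n (univ M)" "z \<in> nlists n (univ M)" for x y z
    using that by (simp add: nlists_def del: nlistsE_length nlistsE_set)
  have eq: "{w \<in> nlists (n + n) (univ M). \<exists>y\<in>nlists n (univ M). y @ w \<in> R}
      = {x @ z | x z. x \<in> P \<and> z \<in> nlists n (univ M) \<and> (\<exists>y\<in>Q. E x y z)}" (is "?A = ?B")
    if R: "\<And>x y z. x \<in> nlists n (univ M) \<Longrightarrow> y \<in> nlists n (univ M) \<Longrightarrow> z \<in> nlists n (univ M)
      \<Longrightarrow> y @ x @ z \<in> R \<longleftrightarrow> y \<in> Q \<and> x \<in> P \<and> E x y z" for R E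
  proof
    show "?A \<subseteq> ?B"
    proof
      fix w assume "w \<in> ?A"
      then obtain y where y: "w \<in> nlists (n + n) (univ M)" "y \<in> nlists n (univ M)" "y @ w \<in> R"
        by auto
      obtain x z where x: "w = x @ z" "x \<in> nlists n (univ M)" "z \<in> nlists n (univ M)"
        using split[OF y(1)] by auto
      have "y \<in> Q \<and> x \<in> P \<and> E x y z" using R[of x y z] x y by simp
      then show "w \<in> ?B" using x by auto
    qed
    show "?B \<subseteq> ?A"
    proof
      fix w assume "w \<in> ?B"
      then obtain x y z where w: "w = x @ z" "x \<in> P" "z \<in> nlists n (univ M)" "y \<in> Q" "E x y z" by blast
      have x: "x \<in> nlists n (univ M)" and y: "y \<in> nlists n (univ M)"
        using sub w(2,4) by auto
      have "y @ w \<in> R" using R[OF x y w(3)] w by simp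
      then show "w \<in> ?A" using w(1) y nlists_appendI[OF x w(3)] by auto
    qed
  qed
  let ?R1 = "?PQ \<inter> {w \<in> ?V. take n (drop n w) @ take n (drop 0 w) @ take n (drop (n + n) w) \<in> \<Gamma>}"
  have "definable L M (n + (n + n)) ?R1"
    using \<Gamma> by (intro definable_Int[OF PQ] definable_blocks3) auto
  moreover have "y @ x @ z \<in> ?R1 \<longleftrightarrow> y \<in> Q \<and> x \<in> P \<and> x @ y @ z \<in> \<Gamma>"
    if "x \<in> nlists n (univ M)" "y \<in> nlists n (univ M)" "z \<in> nlists n (univ M)" for x y z
    using that V by simp
  ultimately show "definable L M (n + n)
      {x @ z | x z. x \<in> P \<and> z \<in> nlists n (univ M) \<and> (\<exists>y\<in>Q. x @ y @ z \<in> \<Gamma>)}"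
    using definable_projection[of L M n "n + n" ?R1] eq[of ?R1 "\<lambda>x y z. x @ y @ z \<in> \<Gamma>"] by simp
  let ?R2 = "?PQ \<inter> {w \<in> ?V. take n (drop (n + n) w) @ take n (drop 0 w) @ take n (drop n w) \<in> \<Gamma>}"
  have "definable L M (n + (n + n)) ?R2"
    using \<Gamma> by (intro definable_Int[OF PQ] definable_blocks3) auto
  moreover have "y @ x @ z \<in> ?R2 \<longleftrightarrow> y \<in> Q \<and> x \<in> P \<and> z @ y @ x \<in> \<Gamma>"
    if "x \<in> nlists n (univ M)" "y \<in> nlists n (univ M)" "z \<in> nlists n (univ M)" for x y z
    using that V by simp
  ultimately show "definable L M (n + n)
      {x @ z | x z. x \<in> P \<and> z \<in> nlists n (univ M) \<and> (\<exists>y\<in>Q. z @ y @ x \<in> \<Gamma>)}"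
    using definable_projection[of L M n "n + n" ?R2] eq[of ?R2 "\<lambda>x y z. z @ y @ x \<in> \<Gamma>"] by simp
qed

section \<open>Ultraproducts and dimension\<close>

lemma equiv_ultra_rel: "equiv (Pi I A) (ultra_rel I U A)"
proof (rule equivI)
  show "ultra_rel I U A \<subseteq> Pi I A \<times> Pi I A" unfolding ultra_rel_def by blast
  show "refl_on (Pi I A) (ultra_rel I U A)"
    unfolding refl_on_def ultra_rel_def by auto
  show "sym (ultra_rel I U A)"
    unfolding sym_def ultra_rel_def by (auto simp: eq_commute)
  show "trans (ultra_rel I U A)"
    unfolding trans_def ultra_rel_def by (auto elim: eventually_elim2)
qed

lemma ultra_class_in_carrier: "g \<in> Pi I A \<Longrightarrow> ultra_class I U A g \<in> ultra_carrier I U A"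
  unfolding ultra_class_def ultra_carrier_def by (rule quotientI)

lemma rep_mem:
  assumes "c \<in> ultra_carrier I U A"
  shows "rep c \<in> c"
proof -
  have "c \<noteq> {}" using assms in_quotient_imp_non_empty[OF equiv_ultra_rel] unfolding ultra_carrier_def by blast
  then show ?thesis unfolding rep_def by (simp add: some_in_eq)
qed

lemma rep_in_Pi:
  assumes "c \<in> ultra_carrier I U A"
  shows "rep c \<in> Pi I A"
  using rep_mem[OF assms] assms in_quotient_imp_subset[OF equiv_ultra_rel]
  unfolding ultra_carrier_def by blast

lemma rep_ultra_class:
  assumes "g \<in> Pi I A"
  shows "\<forall>\<^sub>F i in U. rep (ultra_class I U A g) i = g i"
proof -
  have "rep (ultra_class I U A g) \<in> ultra_rel I U A `` {g}"
    using rep_mem[OF ultra_class_in_carrier[OF assms]] unfolding ultra_class_def .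
  then show ?thesis unfolding ultra_rel_def by (auto elim: eventually_mono)
qed

lemma ultra_carrier_eqI:
  assumes "c \<in> ultra_carrier I U A" "d \<in> ultra_carrier I U A" "\<forall>\<^sub>F i in U. rep c i = rep d i"
  shows "c = d"
proof -
  have "(rep c, rep d) \<in> ultra_rel I U A"
    using assms rep_in_Pi unfolding ultra_rel_def by blast
  then show ?thesis
    using quotient_eqI[OF equiv_ultra_rel] assms rep_mem unfolding ultra_carrier_def
    by (metis (no_types, lifting))
qed

lemma ultra_class_cong:
  assumes "g \<in> Pi I A" "h \<in> Pi I A" "\<forall>\<^sub>F i in U. g i = h i"
  shows "ultra_class I U A g = ultra_class I U A h"
  unfolding ultra_class_def
  using assms by (intro equiv_class_eq[OF equiv_ultra_rel]) (auto simp: ultra_rel_def)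

section \<open>Order of the hyperreals modulo the finite ones\<close>

lemma rep_hclass: "\<forall>\<^sub>F i in U. rep (hclass I U g) i = g i"
  unfolding hclass_def by (rule rep_ultra_class) auto

lemma hclass_in_hreals: "hclass I U g \<in> hreals I U"
  unfolding hclass_def hreals_def by (rule ultra_class_in_carrier) auto

text \<open>The convex hull of the integers consists of the finite hyperreals; a real bound is
  rounded up to an integer one.\<close>

lemma in_conv_ints_iff:
  "x \<in> conv_ints I U \<longleftrightarrow> x \<in> hreals I U \<and> (\<exists>k. \<forall>\<^sub>F i in U. \<bar>rep x i\<bar> \<le> k)"
proof -
  have hint: "\<forall>\<^sub>F i in U. rep (hint I U k) i = of_int k" for k
    unfolding hint_def by (rule rep_hclass)
  have "(\<exists>k l. hle U (hint I U k) x \<and> hle U x (hint I U l)) \<longleftrightarrow> (\<exists>k. \<forall>\<^sub>F i in U. \<bar>rep x i\<bar> \<le> k)"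
  proof
    assume "\<exists>k l. hle U (hint I U k) x \<and> hle U x (hint I U l)"
    then obtain k l where "\<forall>\<^sub>F i in U. rep (hint I U k) i \<le> rep x i"
      "\<forall>\<^sub>F i in U. rep x i \<le> rep (hint I U l) i" unfolding hle_def by blast
    then have "\<forall>\<^sub>F i in U. \<bar>rep x i\<bar> \<le> max \<bar>of_int k\<bar> \<bar>of_int l\<bar>"
      using hint[of k] hint[of l] by eventually_elim auto
    then show "\<exists>k. \<forall>\<^sub>F i in U. \<bar>rep x i\<bar> \<le> k" by blast
  next
    assume "\<exists>k. \<forall>\<^sub>F i in U. \<bar>rep x i\<bar> \<le> k"
    then obtain k where k: "\<forall>\<^sub>F i in U. \<bar>rep x i\<bar> \<le> k" by blast
    have "hle U (hint I U (- \<lceil>k\<rceil>)) x"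
      unfolding hle_def using k hint[of "- \<lceil>k\<rceil>"] by eventually_elim (simp, linarith)
    moreover have "hle U x (hint I U \<lceil>k\<rceil>)"
      unfolding hle_def using k hint[of "\<lceil>k\<rceil>"] by eventually_elim (simp, linarith)
    ultimately show "\<exists>k l. hle U (hint I U k) x \<and> hle U x (hint I U l)" by blast
  qed
  then show ?thesis unfolding conv_ints_def by blast
qed

lemma in_hcoset_iff:
  "y \<in> hcoset I U x \<longleftrightarrow> y \<in> hreals I U \<and> (\<exists>k. \<forall>\<^sub>F i in U. \<bar>rep y i - rep x i\<bar> \<le> k)"
proof -
  have d: "\<forall>\<^sub>F i in U. rep (hdiff I U y x) i = rep y i - rep x i"
    unfolding hdiff_def by (rule rep_hclass)
  have "(\<forall>\<^sub>F i in U. \<bar>rep (hdiff I U y x) i\<bar> \<le> k) \<longleftrightarrow> (\<forall>\<^sub>F i in U. \<bar>rep y i - rep x i\<bar> \<le> k)" for k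
    using d by (intro eventually_subst) (auto elim: eventually_mono)
  moreover have "hdiff I U y x \<in> hreals I U" unfolding hdiff_def by (rule hclass_in_hreals)
  ultimately show ?thesis unfolding hcoset_def by (simp add: in_conv_ints_iff)
qed

lemma hcoset_self: "x \<in> hreals I U \<Longrightarrow> x \<in> hcoset I U x"
  by (auto simp: in_hcoset_iff intro: exI[of _ 0])

lemma hcoset_in_cut_of_self: "x \<in> hreals I U \<Longrightarrow> hcoset I U x \<in> cut_of I U (hcoset I U x)"
  unfolding cut_of_def hquot_def hquot_le_def hle_def
  using hcoset_self[of x I U] by (auto intro!: bexI[of _ x])

lemma cut_of_subset_iff:
  assumes x: "x \<in> hreals I U" and y: "y \<in> hreals I U"
  shows "cut_of I U (hcoset I U x) \<subseteq> cut_of I U (hcoset I U y)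
    \<longleftrightarrow> (\<exists>k. \<forall>\<^sub>F i in U. rep x i \<le> rep y i + k)"
proof
  assume "cut_of I U (hcoset I U x) \<subseteq> cut_of I U (hcoset I U y)"
  then have "hcoset I U x \<in> cut_of I U (hcoset I U y)" using hcoset_in_cut_of_self[OF x] by blast
  then obtain u v k l where uv: "\<forall>\<^sub>F i in U. rep u i \<le> rep v i"
    "\<forall>\<^sub>F i in U. \<bar>rep u i - rep x i\<bar> \<le> k" "\<forall>\<^sub>F i in U. \<bar>rep v i - rep y i\<bar> \<le> l"
    unfolding cut_of_def hquot_le_def hle_def by (auto simp: in_hcoset_iff)
  from uv have "\<forall>\<^sub>F i in U. rep x i \<le> rep y i + (k + l)" by eventually_elim linarith
  then show "\<exists>k. \<forall>\<^sub>F i in U. rep x i \<le> rep y i + k" by blast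
next
  assume "\<exists>k. \<forall>\<^sub>F i in U. rep x i \<le> rep y i + k"
  then obtain k where k: "\<forall>\<^sub>F i in U. rep x i \<le> rep y i + k" by blast
  show "cut_of I U (hcoset I U x) \<subseteq> cut_of I U (hcoset I U y)"
  proof
    fix a assume a: "a \<in> cut_of I U (hcoset I U x)"
    then obtain u v l where a': "a \<in> hquot I U" "u \<in> a" and uv: "\<forall>\<^sub>F i in U. rep u i \<le> rep v i"
      "\<forall>\<^sub>F i in U. \<bar>rep v i - rep x i\<bar> \<le> l"
      unfolding cut_of_def hquot_le_def hle_def by (auto simp: in_hcoset_iff)
    \<comment> \<open>Since v is finitely close to x, moving it by y - x + k lands in the coset of
      y, and the result still bounds u.\<close>
    define w where "w = hclass I U (\<lambda>i. rep v i - rep x i + rep y i + k)"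
    have w: "\<forall>\<^sub>F i in U. rep w i = rep v i - rep x i + rep y i + k"
      unfolding w_def by (rule rep_hclass)
    have "\<forall>\<^sub>F i in U. \<bar>rep w i - rep y i\<bar> \<le> l + \<bar>k\<bar>"
      using w uv(2) by eventually_elim linarith
    then have "w \<in> hcoset I U y" by (auto simp: in_hcoset_iff w_def hclass_in_hreals)
    moreover have "\<forall>\<^sub>F i in U. rep u i \<le> rep w i"
      using w uv(1) k by eventually_elim linarith
    ultimately show "a \<in> cut_of I U (hcoset I U y)"
      using a' unfolding cut_of_def hquot_le_def hle_def by blast
  qed
qed

locale finite_ultraproduct =
  fixes L :: "('f, 'p) language"
    and \<C> :: "('f, 'p, 'a) struct set"
    and U :: "('f, 'p, 'a) struct filter"
  assumes struct: "N \<in> \<C> \<Longrightarrow> is_structure L N"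
    and finite_univ: "N \<in> \<C> \<Longrightarrow> finite (univ N)"
    and ultrafilter: "nonprincipal_ultrafilter_on \<C> U"
begin

abbreviation M :: "('f, 'p, ('f, 'p, 'a) ultra_elem set) struct" where
  "M \<equiv> ultraproduct \<C> U"

lemma eventually_in_class: "\<forall>\<^sub>F N in U. N \<in> \<C>"
  using ultrafilter unfolding nonprincipal_ultrafilter_on_def by blast

lemma not_eventually_False: "\<not> (\<forall>\<^sub>F N in U. False)"
  using ultrafilter unfolding nonprincipal_ultrafilter_on_def by (simp add: trivial_limit_def)

lemma not_eventually_iff: "\<not> (\<forall>\<^sub>F N in U. P N) \<longleftrightarrow> (\<forall>\<^sub>F N in U. \<not> P N)"
proof
  assume "\<not> (\<forall>\<^sub>F N in U. P N)"
  then show "\<forall>\<^sub>F N in U. \<not> P N"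
    using ultrafilter unfolding nonprincipal_ultrafilter_on_def by blast
next
  assume neg: "\<forall>\<^sub>F N in U. \<not> P N"
  show "\<not> (\<forall>\<^sub>F N in U. P N)"
  proof
    assume "\<forall>\<^sub>F N in U. P N"
    with neg have "\<forall>\<^sub>F N in U. False" by eventually_elim simp
    then show False using not_eventually_False by simp
  qed
qed

section \<open>Tuples of the ultraproduct and the theorem of Los\<close>

lemma univ_M: "univ M = ultra_carrier \<C> U univ"
  unfolding ultraproduct_def by simp

definition coord :: "('f, 'p, 'a) struct \<Rightarrow> ('f, 'p, 'a) ultra_elem set list \<Rightarrow> 'a list" where
  "coord N cs = map (\<lambda>c. rep c N) cs"

lemma coord_append [simp]: "coord N (cs @ ds) = coord N cs @ coord N ds"
  and coord_Cons [simp]: "coord N (c # cs) = rep c N # coord N cs"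
  and length_coord [simp]: "length (coord N cs) = length cs"
  unfolding coord_def by simp_all

lemma coord_in_nlists:
  assumes "cs \<in> nlists r (univ M)" "N \<in> \<C>"
  shows "coord N cs \<in> nlists r (univ N)"
proof (rule nlistsI)
  show "length (coord N cs) = r" using assms by simp
  show "set (coord N cs) \<subseteq> univ N"
    using nlistsE_set[OF assms(1)] rep_in_Pi[of _ \<C> U univ] assms(2)
    unfolding coord_def univ_M by fastforce
qed

lemma eventually_coord_in_nlists:
  assumes "cs \<in> nlists r (univ M)"
  shows "\<forall>\<^sub>F N in U. coord N cs \<in> nlists r (univ N)"
  using eventually_in_class by eventually_elim (rule coord_in_nlists[OF assms])

text \<open>The source of all transfer: a counterexample, witness or minimiser chosen separately in
  each factor becomes a point of the ultraproduct.\<close>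

lemma realize:
  assumes s: "\<forall>\<^sub>F N in U. s N \<in> nlists r (univ N)"
  shows "\<exists>cs\<in>nlists r (univ M). \<forall>\<^sub>F N in U. coord N cs = s N"
proof -
  \<comment> \<open>The default value keeps \<open>g i\<close> inside the universe of every factor,
    whereas \<open>s\<close> is controlled only almost everywhere.\<close>
  define g where "g i N = (if s N \<in> nlists r (univ N) then s N ! i else (SOME a. a \<in> univ N))" for i N
  define cs where "cs = map (\<lambda>i. ultra_class \<C> U univ (g i)) [0..<r]"
  have g: "g i \<in> Pi \<C> univ" if "i < r" for i
  proof
    fix N assume "N \<in> \<C>"
    then have "univ N \<noteq> {}" using struct unfolding is_structure_def by blast
    then show "g i N \<in> univ N" unfolding g_def using that by (auto simp: some_in_eq intro: nlistsE_nth_in)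
  qed
  have "cs \<in> nlists r (univ M)"
    unfolding cs_def by (rule nlistsI) (auto simp: univ_M intro!: ultra_class_in_carrier g)
  moreover have "\<forall>\<^sub>F N in U. \<forall>i\<in>{..<r}. rep (ultra_class \<C> U univ (g i)) N = g i N"
    using g by (intro eventually_ball_finite) (auto intro: rep_ultra_class)
  with s have "\<forall>\<^sub>F N in U. coord N cs = s N"
  proof eventually_elim
    case (elim N)
    then show ?case unfolding coord_def cs_def by (intro nth_equalityI) (auto simp: g_def)
  qed
  ultimately show ?thesis by blast
qed

lemma los_tm:
  assumes "wf_tm L (length cs) t" "set cs \<subseteq> univ M"
  shows "eval_tm M cs t \<in> univ M \<and> (\<forall>\<^sub>F N in U. rep (eval_tm M cs t) N = eval_tm N (coord N cs) t)"
  using assms(1)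
proof (induction t)
  case (Var i)
  then show ?case using assms(2) by (auto simp: coord_def)
next
  case (Fun f ts)
  let ?es = "map (eval_tm M cs) ts"
  have es: "?es \<in> nlists (farity L f) (univ M)"
    using Fun by (intro nlistsI) auto
  let ?g = "\<lambda>N. fint N f (map (\<lambda>c. rep c N) ?es)"
  have g: "?g \<in> Pi \<C> univ"
  proof
    fix N assume N: "N \<in> \<C>"
    show "?g N \<in> univ N"
      using struct[OF N] coord_in_nlists[OF es N] Fun.prems
      unfolding is_structure_def coord_def by auto
  qed
  have ev: "eval_tm M cs (Fun f ts) = ultra_class \<C> U univ ?g"
    by (simp add: ultraproduct_def)
  have "\<forall>\<^sub>F N in U. \<forall>t\<in>set ts. rep (eval_tm M cs t) N = eval_tm N (coord N cs) t"
    using Fun by (intro eventually_ball_finite) auto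
  then have "\<forall>\<^sub>F N in U. rep (eval_tm M cs (Fun f ts)) N = eval_tm N (coord N cs) (Fun f ts)"
    using rep_ultra_class[OF g] unfolding ev
  proof eventually_elim
    case (elim N)
    have "map (\<lambda>c. rep c N) ?es = map (eval_tm N (coord N cs)) ts" using elim(1) by simp
    then show ?case using elim(2) by (simp del: map_map)
  qed
  then show ?case using ultra_class_in_carrier[OF g] unfolding ev univ_M by blast
qed

theorem los:
  assumes "wf_fm L (length cs) \<phi>" "set cs \<subseteq> univ M"
  shows "sat M cs \<phi> \<longleftrightarrow> (\<forall>\<^sub>F N in U. sat N (coord N cs) \<phi>)"
  using assms
proof (induction \<phi> arbitrary: cs)
  case (Equal t u)
  note t = los_tm[of cs t] and u = los_tm[of cs u]
  have "eval_tm M cs t = eval_tm M cs u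
    \<longleftrightarrow> (\<forall>\<^sub>F N in U. rep (eval_tm M cs t) N = rep (eval_tm M cs u) N)"
  proof
    assume "\<forall>\<^sub>F N in U. rep (eval_tm M cs t) N = rep (eval_tm M cs u) N"
    then show "eval_tm M cs t = eval_tm M cs u"
      using t u Equal ultra_carrier_eqI[of "eval_tm M cs t" \<C> U univ "eval_tm M cs u"]
      by (simp add: univ_M)
  qed simp
  also have "\<dots> \<longleftrightarrow> (\<forall>\<^sub>F N in U. eval_tm N (coord N cs) t = eval_tm N (coord N cs) u)"
  proof -
    have "\<forall>\<^sub>F N in U. rep (eval_tm M cs t) N = eval_tm N (coord N cs) t"
      "\<forall>\<^sub>F N in U. rep (eval_tm M cs u) N = eval_tm N (coord N cs) u" using t u Equal by auto
    then have "\<forall>\<^sub>F N in U. (rep (eval_tm M cs t) N = rep (eval_tm M cs u) N)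
        = (eval_tm N (coord N cs) t = eval_tm N (coord N cs) u)" by eventually_elim simp
    then show ?thesis by (rule eventually_subst)
  qed
  finally show ?case by simp
next
  case (Rel p ts)
  have "\<forall>\<^sub>F N in U. \<forall>t\<in>set ts. rep (eval_tm M cs t) N = eval_tm N (coord N cs) t"
    using Rel los_tm by (intro eventually_ball_finite) auto
  then have "\<forall>\<^sub>F N in U. rint N p (map (\<lambda>c. rep c N) (map (eval_tm M cs) ts))
      = rint N p (map (eval_tm N (coord N cs)) ts)"
  proof eventually_elim
    case (elim N)
    have "map (\<lambda>c. rep c N) (map (eval_tm M cs) ts) = map (eval_tm N (coord N cs)) ts" using elim by simp
    then show ?case by metis
  qed
  then show ?case using eventually_subst by (fastforce simp: ultraproduct_def)
next
  case (Neg \<phi>)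
  then show ?case using not_eventually_iff[of "\<lambda>N. sat N (coord N cs) \<phi>"] by auto
next
  case (Conj \<phi> \<psi>)
  then show ?case by (auto simp: eventually_conj_iff)
next
  case (Exists \<phi>)
  have IH: "sat M (a # cs) \<phi> \<longleftrightarrow> (\<forall>\<^sub>F N in U. sat N (rep a N # coord N cs) \<phi>)" if "a \<in> univ M" for a
    using Exists.IH[of "a # cs"] Exists.prems that by simp
  show ?case
  proof
    assume "sat M cs (Exists \<phi>)"
    then obtain a where a: "a \<in> univ M" "\<forall>\<^sub>F N in U. sat N (rep a N # coord N cs) \<phi>" using IH by auto
    have "\<forall>\<^sub>F N in U. rep a N \<in> univ N"
      using eventually_in_class rep_in_Pi[of a \<C> U univ] a(1) unfolding univ_M
      by (auto elim: eventually_mono)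
    with a(2) show "\<forall>\<^sub>F N in U. sat N (coord N cs) (Exists \<phi>)" by eventually_elim auto
  next
    assume ex: "\<forall>\<^sub>F N in U. sat N (coord N cs) (Exists \<phi>)"
    \<comment> \<open>Witnesses chosen factor by factor are glued to one element, by way of lists of
      length 1 because \<open>realize\<close> speaks of tuples.\<close>
    define b where "b N = (SOME b. b \<in> univ N \<and> sat N (b # coord N cs) \<phi>)" for N
    have b: "\<forall>\<^sub>F N in U. b N \<in> univ N \<and> sat N (b N # coord N cs) \<phi>"
      using ex
    proof eventually_elim
      case (elim N)
      then have "\<exists>b. b \<in> univ N \<and> sat N (b # coord N cs) \<phi>" by auto
      then show ?case unfolding b_def by (rule someI_ex)
    qed
    then have "\<forall>\<^sub>F N in U. [b N] \<in> nlists 1 (univ N)" by eventually_elim (auto intro: nlistsI)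
    then obtain as where as: "as \<in> nlists 1 (univ M)" "\<forall>\<^sub>F N in U. coord N as = [b N]"
      using realize[of "\<lambda>N. [b N]" 1] by blast
    have "length as = 1" using nlistsE_length[OF as(1)] .
    then obtain a where a: "as = [a]" by (auto simp: length_Suc_conv)
    then have aM: "a \<in> univ M" using nlistsE_set[OF as(1)] by simp
    from b as(2) have "\<forall>\<^sub>F N in U. sat N (rep a N # coord N cs) \<phi>"
      unfolding a by eventually_elim simp
    then show "sat M cs (Exists \<phi>)" using IH aM by auto
  qed
qed

section \<open>Internal sets and the slices of definable sets\<close>

definition ultraset :: "nat \<Rightarrow> (('f, 'p, 'a) struct \<Rightarrow> 'a list set) \<Rightarrow> ('f, 'p, 'a) ultra_elem set list set" where
  "ultraset r S = {cs \<in> nlists r (univ M). \<forall>\<^sub>F N in U. coord N cs \<in> S N}"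

lemma solset_eq_ultraset:
  assumes "as \<in> lists (univ M)" "wf_fm L (r + length as) \<phi>"
  shows "solset M r \<phi> as = ultraset r (\<lambda>N. solset N r \<phi> (coord N as))"
proof -
  have "sat M (xs @ as) \<phi> \<longleftrightarrow> (\<forall>\<^sub>F N in U. coord N xs \<in> solset N r \<phi> (coord N as))"
    if xs: "xs \<in> nlists r (univ M)" for xs
  proof -
    have "sat M (xs @ as) \<phi> \<longleftrightarrow> (\<forall>\<^sub>F N in U. sat N (coord N (xs @ as)) \<phi>)"
      using assms nlistsE_set[OF xs] nlistsE_length[OF xs] by (intro los) auto
    also have "\<dots> \<longleftrightarrow> (\<forall>\<^sub>F N in U. coord N xs \<in> solset N r \<phi> (coord N as))"
      using eventually_coord_in_nlists[OF xs] unfolding solset_def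
      by (intro eventually_subst) (auto elim: eventually_mono)
    finally show ?thesis .
  qed
  then show ?thesis unfolding ultraset_def solset_def[of M] by blast
qed

text \<open>If the conclusion failed, counterexamples chosen in almost all factors would form a
  point of the internal set. \<open>P\<close> may be any family of predicates and not only one given
  by a formula, which is what lets cardinality estimates be transferred.\<close>

lemma transfer_ball:
  assumes S: "\<And>N. S N \<subseteq> nlists r (univ N)"
    and P: "\<And>cs. cs \<in> ultraset r S \<Longrightarrow> \<forall>\<^sub>F N in U. P N (coord N cs)"
  shows "\<forall>\<^sub>F N in U. \<forall>x\<in>S N. P N x"
proof (rule ccontr)
  assume "\<not> ?thesis"
  then have "\<forall>\<^sub>F N in U. \<not> (\<forall>x\<in>S N. P N x)" by (rule not_eventually_iff[THEN iffD1])
  then have neg: "\<forall>\<^sub>F N in U. \<exists>x. x \<in> S N \<and> \<not> P N x" by eventually_elim blast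
  define s where "s N = (SOME x. x \<in> S N \<and> \<not> P N x)" for N
  have s: "\<forall>\<^sub>F N in U. s N \<in> S N \<and> \<not> P N (s N)"
    using neg unfolding s_def by eventually_elim (rule someI_ex)
  have "\<forall>\<^sub>F N in U. s N \<in> nlists r (univ N)"
    using s
  proof eventually_elim
    case (elim N)
    then show ?case using S[of N] by blast
  qed
  then obtain cs where cs: "cs \<in> nlists r (univ M)" "\<forall>\<^sub>F N in U. coord N cs = s N"
    using realize[of s r] by blast
  from cs(2) s have *: "\<forall>\<^sub>F N in U. coord N cs \<in> S N \<and> \<not> P N (coord N cs)" by eventually_elim simp
  then have "cs \<in> ultraset r S" using cs(1) unfolding ultraset_def by (auto elim: eventually_mono)
  from P[OF this] * have "\<forall>\<^sub>F N in U. False" by eventually_elim simp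
  then show False using not_eventually_False by simp
qed

text \<open>The choice is junk for sets that are not definable; for definable ones it is unique almost
  everywhere.\<close>

definition slice :: "nat \<Rightarrow> ('f, 'p, 'a) ultra_elem set list set \<Rightarrow> ('f, 'p, 'a) struct \<Rightarrow> 'a list set" where
  "slice r X = (SOME S. X = ultraset r S \<and> (\<forall>N. S N \<subseteq> nlists r (univ N)))"

lemma slice_properties:
  assumes "definable L M r X"
  shows "X = ultraset r (slice r X)" "slice r X N \<subseteq> nlists r (univ N)"
proof -
  have "\<exists>S. X = ultraset r S \<and> (\<forall>N. S N \<subseteq> nlists r (univ N))"
    using assms solset_eq_ultraset unfolding definable_def solset_def
    by (metis (no_types, lifting) mem_Collect_eq subsetI)
  from someI_ex[OF this] show "X = ultraset r (slice r X)" "slice r X N \<subseteq> nlists r (univ N)"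
    unfolding slice_def by blast+
qed

lemma in_definable_iff:
  assumes "definable L M r X" "cs \<in> nlists r (univ M)"
  shows "cs \<in> X \<longleftrightarrow> (\<forall>\<^sub>F N in U. coord N cs \<in> slice r X N)"
proof -
  have "cs \<in> X \<longleftrightarrow> cs \<in> ultraset r (slice r X)" using slice_properties(1)[OF assms(1)] by simp
  then show ?thesis using assms(2) unfolding ultraset_def by simp
qed

lemma transfer_slice:
  assumes "definable L M r X" "\<And>cs. cs \<in> X \<Longrightarrow> \<forall>\<^sub>F N in U. P N (coord N cs)"
  shows "\<forall>\<^sub>F N in U. \<forall>x\<in>slice r X N. P N x"
  using slice_properties[OF assms(1)] assms(2) by (intro transfer_ball) auto

lemma finite_slice:
  assumes "definable L M r X" "N \<in> \<C>"
  shows "finite (slice r X N)"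
proof (rule finite_subset)
  show "slice r X N \<subseteq> {xs. set xs \<subseteq> univ N \<and> length xs = r}"
    using slice_properties(2)[OF assms(1), of N] unfolding nlists_def by blast
  show "finite {xs. set xs \<subseteq> univ N \<and> length xs = r}"
    using finite_univ[OF assms(2)] by (rule finite_lists_length_eq)
qed

text \<open>One transfer for each inclusion. This identifies the arbitrarily chosen slices with
  explicitly given families.\<close>

lemma slice_unique:
  assumes X: "definable L M r X" and S: "\<And>N. S N \<subseteq> nlists r (univ N)" and eq: "X = ultraset r S"
  shows "\<forall>\<^sub>F N in U. slice r X N = S N"
proof -
  have "\<forall>\<^sub>F N in U. \<forall>x\<in>slice r X N. x \<in> S N"
    using X eq by (intro transfer_slice) (auto simp: ultraset_def)
  moreover have "\<forall>\<^sub>F N in U. \<forall>x\<in>S N. x \<in> slice r X N"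
    using S eq in_definable_iff[OF X] definable_subset[OF X] by (intro transfer_ball) auto
  ultimately show ?thesis by eventually_elim blast
qed

lemma slice_empty: "\<forall>\<^sub>F N in U. slice r {} N = {}" if "definable L M r {}"
  using that not_eventually_False by (intro slice_unique) (auto simp: ultraset_def)

lemma slice_nonempty:
  assumes "definable L M r X" "x \<in> X"
  shows "\<forall>\<^sub>F N in U. slice r X N \<noteq> {}"
proof -
  have "\<forall>\<^sub>F N in U. coord N x \<in> slice r X N"
    using assms in_definable_iff[OF assms(1), of x] definable_subset[OF assms(1)] by blast
  then show ?thesis by eventually_elim blast
qed

text \<open>Different formulas for X have solution sets that agree in almost all factors, so the
  definite description has one value. A point of X fixes the arity, over which the description also
  ranges.\<close>

lemma hcard_eq:
  assumes X: "definable L M r X" and ne: "X \<noteq> {}"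
  shows "hcard L \<C> U X = hclass \<C> U (\<lambda>N. real (card (slice r X N)))"
proof -
  have unique: "count_fun \<C> U r' \<phi> as = hclass \<C> U (\<lambda>N. real (card (slice r X N)))"
    if as: "as \<in> lists (univ M)" "wf_fm L (r' + length as) \<phi>" "X = solset M r' \<phi> as" for r' \<phi> as
  proof -
    obtain x where "x \<in> X" using ne by blast
    then have "x \<in> nlists r (univ M)" "x \<in> nlists r' (univ M)"
      using definable_subset[OF X] that(3) unfolding solset_def by blast+
    then have r: "r' = r" using nlistsE_length by blast
    have "\<forall>\<^sub>F N in U. slice r X N = solset N r \<phi> (coord N as)"
      using that solset_eq_ultraset[OF as(1,2)] unfolding r
      by (intro slice_unique[OF X]) (auto simp: solset_def)
    then have "\<forall>\<^sub>F N in U. real (card (solset N r \<phi> (coord N as))) = real (card (slice r X N))"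
      by eventually_elim simp
    then show ?thesis unfolding count_fun_def hclass_def r coord_def by (intro ultra_class_cong) auto
  qed
  show ?thesis unfolding hcard_def
  proof (rule the_equality)
    show "\<exists>r' \<phi> as. as \<in> lists (univ M) \<and> wf_fm L (r' + length as) \<phi> \<and> X = solset M r' \<phi> as
       \<and> hclass \<C> U (\<lambda>N. real (card (slice r X N))) = count_fun \<C> U r' \<phi> as"
      using X unique unfolding definable_def by metis
  qed (use unique in blast)
qed

text \<open>The quotient by the finite hyperreals forgets additive constants in the logarithm, that
  is, multiplicative constants in the cardinality.\<close>

lemma \<delta>_le_iff:
  assumes X: "definable L M r X" and Y: "definable L M r Y"
  shows "\<delta> L \<C> U X \<le> \<delta> L \<C> U Y
    \<longleftrightarrow> (\<exists>c. \<forall>\<^sub>F N in U. real (card (slice r X N)) \<le> c * real (card (slice r Y N)))"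
proof (cases "X = {}")
  case True
  then have "\<forall>\<^sub>F N in U. slice r X N = {}" using slice_empty X by simp
  then have "\<forall>\<^sub>F N in U. real (card (slice r X N)) \<le> 1 * real (card (slice r Y N))"
    by eventually_elim simp
  then have "\<exists>c. \<forall>\<^sub>F N in U. real (card (slice r X N)) \<le> c * real (card (slice r Y N))" ..
  then show ?thesis using True unfolding \<delta>_def by simp
next
  case Xne: False
  have hX: "hlog \<C> U (hcard L \<C> U X) \<in> hreals \<C> U" for X
    unfolding hlog_def by (rule hclass_in_hreals)
  have pos: "\<forall>\<^sub>F N in U. real (card (slice r X N)) > 0" if "definable L M r X" "X \<noteq> {}" for X
  proof -
    from that obtain x where "x \<in> X" by blast
    from slice_nonempty[OF that(1) this] eventually_in_class show ?thesis
      by eventually_elim (simp add: card_gt_0_iff finite_slice[OF that(1)])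
  qed
  show ?thesis
  proof (cases "Y = {}")
    case True
    have "\<not> (\<forall>\<^sub>F N in U. real (card (slice r X N)) \<le> c * real (card (slice r Y N)))" for c
    proof
      assume "\<forall>\<^sub>F N in U. real (card (slice r X N)) \<le> c * real (card (slice r Y N))"
      moreover have "\<forall>\<^sub>F N in U. slice r Y N = {}" using slice_empty Y True by simp
      ultimately have "\<forall>\<^sub>F N in U. False" using pos[OF X Xne] by eventually_elim simp
      then show False using not_eventually_False by simp
    qed
    then show ?thesis using hcoset_in_cut_of_self[OF hX[of X]] Xne True unfolding \<delta>_def by auto
  next
    case Yne: False
    have rep: "\<forall>\<^sub>F N in U. rep (hlog \<C> U (hcard L \<C> U X)) N = ln (real (card (slice r X N)))"
      if "definable L M r X" "X \<noteq> {}" for X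
      using rep_hclass[of \<C> U "\<lambda>N. ln (rep (hcard L \<C> U X) N)"]
        rep_hclass[of \<C> U "\<lambda>N. real (card (slice r X N))"]
      unfolding hlog_def hcard_eq[OF that] by eventually_elim simp
    note ev = rep[OF X Xne] rep[OF Y Yne] pos[OF X Xne] pos[OF Y Yne]
    have "(\<exists>k. \<forall>\<^sub>F N in U. rep (hlog \<C> U (hcard L \<C> U X)) N \<le> rep (hlog \<C> U (hcard L \<C> U Y)) N + k)
      \<longleftrightarrow> (\<exists>c. \<forall>\<^sub>F N in U. real (card (slice r X N)) \<le> c * real (card (slice r Y N)))"
      (is "?l \<longleftrightarrow> ?r")
    proof
      assume ?l
      then obtain k where "\<forall>\<^sub>F N in U. rep (hlog \<C> U (hcard L \<C> U X)) N
        \<le> rep (hlog \<C> U (hcard L \<C> U Y)) N + k" by blast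
      then have "\<forall>\<^sub>F N in U. real (card (slice r X N)) \<le> exp k * real (card (slice r Y N))"
        using ev
      proof eventually_elim
        case (elim N)
        then have "exp (ln (real (card (slice r X N)))) \<le> exp (ln (real (card (slice r Y N))) + k)"
          unfolding exp_le_cancel_iff by simp
        moreover have "exp (ln (real (card (slice r X N)))) = real (card (slice r X N))"
          "exp (ln (real (card (slice r Y N)))) = real (card (slice r Y N))"
          using elim by (auto intro!: exp_ln)
        ultimately show ?case by (simp add: exp_add mult.commute)
      qed
      then show ?r by blast
    next
      assume ?r
      then obtain c where "\<forall>\<^sub>F N in U. real (card (slice r X N)) \<le> c * real (card (slice r Y N))" by blast
      then have "\<forall>\<^sub>F N in U. rep (hlog \<C> U (hcard L \<C> U X)) N
        \<le> rep (hlog \<C> U (hcard L \<C> U Y)) N + ln c"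
        using ev
      proof eventually_elim
        case (elim N)
        \<comment> \<open>Splitting the logarithm needs c > 0, which holds because the slice of X is
          nonempty.\<close>
        then have "c * real (card (slice r Y N)) > 0" by linarith
        then have c: "c > 0" using elim by (simp add: zero_less_mult_iff)
        have "ln (real (card (slice r X N))) \<le> ln (c * real (card (slice r Y N)))"
          using elim by simp
        also have "\<dots> = ln c + ln (real (card (slice r Y N)))" using c elim by (simp add: ln_mult)
        finally show ?case using elim by simp
      qed
      then show ?l by blast
    qed
    then show ?thesis using cut_of_subset_iff[OF hX[of X] hX[of Y]] Xne Yne unfolding \<delta>_def by simp
  qed
qed

section \<open>Definability of fibres and of conditions on their dimension\<close>

lemma definable_fibre:
  assumes Z: "definable L M (r + s) Z" and ys: "ys \<in> nlists s (univ M)"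
  shows "definable L M r {xs \<in> nlists r (univ M). xs @ ys \<in> Z}"
proof -
  obtain \<phi> as where as: "as \<in> lists (univ M)" and wf: "wf_fm L (r + s + length as) \<phi>"
    and Z: "Z = solset M (r + s) \<phi> as"
    using Z unfolding definable_def by blast
  have "{xs \<in> nlists r (univ M). xs @ ys \<in> Z} = solset M r \<phi> (ys @ as)"
    unfolding Z solset_def using ys by (auto intro: nlists_appendI)
  moreover have "ys @ as \<in> lists (univ M)" using as nlistsE_set[OF ys] by auto
  moreover have "wf_fm L (r + length (ys @ as)) \<phi>"
    using wf nlistsE_length[OF ys] by (simp add: add.assoc)
  ultimately show ?thesis unfolding definable_def by blast
qed

text \<open>The fibre over \<open>ys\<close> is defined by \<psi> with parameters
  \<open>ys @ bs\<close>. Dimension comparison therefore applies with \<open>ys\<close> left free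
  and the other parameters fixed.\<close>

lemma definable_\<delta>_le:
  assumes DC: "dimension_comparison L \<C> U"
    and Y: "definable L M r Y" and Z: "definable L M (r + s) Z"
  shows "definable L M s
    {ys \<in> nlists s (univ M). \<delta> L \<C> U Y \<le> \<delta> L \<C> U {xs \<in> nlists r (univ M). xs @ ys \<in> Z}}"
proof -
  obtain \<phi> as where as: "as \<in> lists (univ M)" and wf: "wf_fm L (r + length as) \<phi>"
    and Y: "Y = solset M r \<phi> as"
    using Y unfolding definable_def by blast
  obtain \<psi> bs where bs: "bs \<in> lists (univ M)" and wf': "wf_fm L (r + s + length bs) \<psi>"
    and Z: "Z = solset M (r + s) \<psi> bs"
    using Z unfolding definable_def by blast
  obtain \<chi> where \<chi>: "wf_fm L (length as + (s + length bs)) \<chi>"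
    and sat: "\<And>cs ds. cs \<in> nlists (length as) (univ M) \<Longrightarrow> ds \<in> nlists (s + length bs) (univ M) \<Longrightarrow>
      sat M (cs @ ds) \<chi> \<longleftrightarrow> \<delta> L \<C> U (solset M r \<phi> cs) \<le> \<delta> L \<C> U (solset M r \<psi> ds)"
  proof -
    have "wf_fm L (r + (s + length bs)) \<psi>" using wf' by (simp add: add.assoc)
    with wf show ?thesis using DC that unfolding dimension_comparison_def by blast
  qed
  \<comment> \<open>\<chi> expects the order \<open>as\<close>, \<open>ys\<close>,
    \<open>bs\<close>, but the free block \<open>ys\<close> must come first, so the first two blocks
    are exchanged.\<close>
  define f where "f i = (if i < length as then s + i else if i < length as + s then i - length as else i)" for i
  have "\<delta> L \<C> U Y \<le> \<delta> L \<C> U {xs \<in> nlists r (univ M). xs @ ys \<in> Z}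
      \<longleftrightarrow> sat M (ys @ as @ bs) (rename_fm f \<chi>)" if ys: "ys \<in> nlists s (univ M)" for ys
  proof -
    have len: "length ys = s" using ys by simp
    have "sat M (ys @ as @ bs) (rename_fm f \<chi>) \<longleftrightarrow> sat M (as @ ys @ bs) \<chi>"
      using len by (intro sat_rename_fm[OF \<chi>]) (auto simp: f_def nth_append add.commute)
    also have "\<dots> \<longleftrightarrow> \<delta> L \<C> U (solset M r \<phi> as) \<le> \<delta> L \<C> U (solset M r \<psi> (ys @ bs))"
    proof (rule sat)
      show "as \<in> nlists (length as) (univ M)" using as by (intro nlistsI) auto
      show "ys @ bs \<in> nlists (s + length bs) (univ M)"
        using bs by (intro nlists_appendI[OF ys] nlistsI) auto
    qed
    also have "solset M r \<psi> (ys @ bs) = {xs \<in> nlists r (univ M). xs @ ys \<in> Z}"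
      unfolding Z solset_def using ys by (auto intro: nlists_appendI)
    finally show ?thesis unfolding Y by blast
  qed
  then have "{ys \<in> nlists s (univ M). \<delta> L \<C> U Y \<le> \<delta> L \<C> U {xs \<in> nlists r (univ M). xs @ ys \<in> Z}}
      = solset M s (rename_fm f \<chi>) (as @ bs)" unfolding solset_def by blast
  moreover have "wf_fm L (s + length (as @ bs)) (rename_fm f \<chi>)"
    by (intro wf_rename_fm[OF \<chi>]) (auto simp: f_def)
  moreover have "as @ bs \<in> lists (univ M)" using as bs by simp
  ultimately show ?thesis unfolding definable_def by blast
qed

end

section \<open>Definable groups in ultraproducts\<close>

locale ultraproduct_group = finite_ultraproduct L \<C> U + group G
  for L :: "('f, 'p) language"
    and \<C> :: "('f, 'p, 'a) struct set"
    and U :: "('f, 'p, 'a) struct filter"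
    and G :: "('f, 'p, 'a) ultra_elem set list monoid" (structure) +
  fixes n :: nat
  assumes group_definable: "definable_group L (ultraproduct \<C> U) n G"
begin

section \<open>The finite groups induced on the slices\<close>

definition graph :: "('f, 'p, 'a) ultra_elem set list set" where
  "graph = {x @ y @ (x \<otimes> y) | x y. x \<in> carrier G \<and> y \<in> carrier G}"

lemma definable_carrier: "definable L M n (carrier G)"
  and definable_graph: "definable L M (3 * n) graph"
  using group_definable unfolding definable_group_def graph_def by auto

lemma carrier_subset: "x \<in> carrier G \<Longrightarrow> x \<in> nlists n (univ M)"
  using definable_subset[OF definable_carrier] by blast

lemma in_graph_iff:
  assumes "x \<in> nlists n (univ M)" "y \<in> nlists n (univ M)"
  shows "x @ y @ z \<in> graph \<longleftrightarrow> x \<in> carrier G \<and> y \<in> carrier G \<and> z = x \<otimes> y"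
proof
  assume "x @ y @ z \<in> graph"
  then obtain x' y' where *: "x @ y @ z = x' @ y' @ (x' \<otimes> y')" "x' \<in> carrier G" "y' \<in> carrier G"
    unfolding graph_def by blast
  have len: "length x = length x'" "length y = length y'"
    using assms *(2,3)[THEN carrier_subset] nlistsE_length by metis+
  from *(1) len have "x = x'" "y = y'" "z = x' \<otimes> y'" by auto
  then show "x \<in> carrier G \<and> y \<in> carrier G \<and> z = x \<otimes> y" using *(2,3) by simp
qed (auto simp: graph_def)

text \<open>The slice of the graph is guaranteed to be the graph of an operation only in almost all
  factors; elsewhere the chosen product is arbitrary.\<close>

definition slice_group :: "('f, 'p, 'a) struct \<Rightarrow> 'a list monoid" where
  "slice_group N = \<lparr> carrier = slice n (carrier G) N,
     mult = (\<lambda>x y. SOME z. z \<in> nlists n (univ N) \<and> x @ y @ z \<in> slice (3 * n) graph N),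
     one = coord N \<one> \<rparr>"

lemma carrier_slice_group [simp]: "carrier (slice_group N) = slice n (carrier G) N"
  and one_slice_group [simp]: "\<one>\<^bsub>slice_group N\<^esub> = coord N \<one>"
  unfolding slice_group_def by simp_all

lemma coord_in_slice:
  assumes "definable L M n X" "x \<in> X"
  shows "\<forall>\<^sub>F N in U. coord N x \<in> slice n X N"
  using assms in_definable_iff definable_subset by blast

lemma coord_mult:
  assumes x: "x \<in> carrier G" and y: "y \<in> carrier G"
  shows "\<forall>\<^sub>F N in U. coord N x \<otimes>\<^bsub>slice_group N\<^esub> coord N y = coord N (x \<otimes> y)"
proof -
  let ?xy = "x \<otimes> y"
  note mem = carrier_subset[OF x] carrier_subset[OF y]
  have xy: "?xy \<in> nlists n (univ M)" using x y by (intro carrier_subset) simp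
  have app: "x @ y @ z \<in> nlists (3 * n) (univ M)" if "z \<in> nlists n (univ M)" for z
  proof -
    have "x @ y @ z \<in> nlists (n + (n + n)) (univ M)" using mem that by (intro nlists_appendI)
    then show ?thesis by (simp add: mult.commute numeral_3_eq_3)
  qed
  \<comment> \<open>The choice in the product must be forced: a different value, available in almost
    all factors, would be a second product in the ultraproduct.\<close>
  have "\<forall>\<^sub>F N in U. \<forall>z\<in>nlists n (univ N).
      coord N x @ coord N y @ z \<in> slice (3 * n) graph N \<longrightarrow> z = coord N ?xy"
  proof (rule transfer_ball[where r = n])
    fix z assume "z \<in> ultraset n (\<lambda>N. nlists n (univ N))"
    then have z: "z \<in> nlists n (univ M)" unfolding ultraset_def by blast
    show "\<forall>\<^sub>F N in U. coord N x @ coord N y @ coord N z \<in> slice (3 * n) graph N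
        \<longrightarrow> coord N z = coord N ?xy"
    proof (cases "z = ?xy")
      case False
      then have "\<not> (\<forall>\<^sub>F N in U. coord N (x @ y @ z) \<in> slice (3 * n) graph N)"
        using in_definable_iff[OF definable_graph app[OF z]] in_graph_iff[OF mem] by simp
      then have "\<forall>\<^sub>F N in U. coord N (x @ y @ z) \<notin> slice (3 * n) graph N"
        by (rule not_eventually_iff[THEN iffD1])
      then show ?thesis by eventually_elim simp
    qed simp
  qed simp
  moreover have "\<forall>\<^sub>F N in U. coord N (x @ y @ ?xy) \<in> slice (3 * n) graph N"
    using in_definable_iff[OF definable_graph app[OF xy]] in_graph_iff[OF mem] x y by simp
  ultimately show ?thesis using eventually_coord_in_nlists[OF xy]
  proof eventually_elim
    case (elim N)
    have "(SOME z. z \<in> nlists n (univ N) \<and> coord N x @ coord N y @ z \<in> slice (3 * n) graph N)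
        = coord N ?xy"
    proof (rule some_equality)
      show "coord N ?xy \<in> nlists n (univ N) \<and> coord N x @ coord N y @ coord N ?xy \<in> slice (3 * n) graph N"
        using elim(2,3) by simp
    qed (use elim(1) in blast)
    then show ?case unfolding slice_group_def by simp
  qed
qed

text \<open>Each axiom is universal over the carrier, and nested transfer reduces it to the same
  axiom at points of \<open>G\<close>. For inverses, the coordinate of \<open>inv x\<close> is the
  witness.\<close>

lemma group_slice_group: "\<forall>\<^sub>F N in U. group (slice_group N)"
proof -
  note tr = transfer_slice[OF definable_carrier]
  note mem = coord_in_slice[OF definable_carrier]
  have closed: "\<forall>\<^sub>F N in U. \<forall>x\<in>slice n (carrier G) N. \<forall>y\<in>slice n (carrier G) N.
      x \<otimes>\<^bsub>slice_group N\<^esub> y \<in> slice n (carrier G) N"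
  proof (intro tr)
    fix x y assume xy: "x \<in> carrier G" "y \<in> carrier G"
    show "\<forall>\<^sub>F N in U. coord N x \<otimes>\<^bsub>slice_group N\<^esub> coord N y \<in> slice n (carrier G) N"
      using coord_mult[OF xy] mem[OF m_closed[OF xy]] by eventually_elim simp
  qed
  have assoc: "\<forall>\<^sub>F N in U. \<forall>x\<in>slice n (carrier G) N. \<forall>y\<in>slice n (carrier G) N. \<forall>z\<in>slice n (carrier G) N.
      x \<otimes>\<^bsub>slice_group N\<^esub> y \<otimes>\<^bsub>slice_group N\<^esub> z = x \<otimes>\<^bsub>slice_group N\<^esub> (y \<otimes>\<^bsub>slice_group N\<^esub> z)"
  proof (intro tr)
    fix x y z assume xyz: "x \<in> carrier G" "y \<in> carrier G" "z \<in> carrier G"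
    show "\<forall>\<^sub>F N in U. coord N x \<otimes>\<^bsub>slice_group N\<^esub> coord N y \<otimes>\<^bsub>slice_group N\<^esub> coord N z
      = coord N x \<otimes>\<^bsub>slice_group N\<^esub> (coord N y \<otimes>\<^bsub>slice_group N\<^esub> coord N z)"
      using coord_mult[OF xyz(1,2)] coord_mult[OF xyz(2,3)]
        coord_mult[OF m_closed[OF xyz(1,2)] xyz(3)] coord_mult[OF xyz(1) m_closed[OF xyz(2,3)]]
      by eventually_elim (simp add: m_assoc[OF xyz])
  qed
  have unit: "\<forall>\<^sub>F N in U. \<forall>x\<in>slice n (carrier G) N. coord N \<one> \<otimes>\<^bsub>slice_group N\<^esub> x = x"
  proof (intro tr)
    fix x assume x: "x \<in> carrier G"
    show "\<forall>\<^sub>F N in U. coord N \<one> \<otimes>\<^bsub>slice_group N\<^esub> coord N x = coord N x"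
      using coord_mult[OF one_closed x] by eventually_elim (simp add: x)
  qed
  have inverse: "\<forall>\<^sub>F N in U. \<forall>x\<in>slice n (carrier G) N. \<exists>y\<in>slice n (carrier G) N.
      y \<otimes>\<^bsub>slice_group N\<^esub> x = coord N \<one>"
  proof (intro tr)
    fix x assume x: "x \<in> carrier G"
    show "\<forall>\<^sub>F N in U. \<exists>y\<in>slice n (carrier G) N. y \<otimes>\<^bsub>slice_group N\<^esub> coord N x = coord N \<one>"
      using coord_mult[OF inv_closed[OF x] x] mem[OF inv_closed[OF x]]
    proof eventually_elim
      case (elim N)
      then show ?case using l_inv[OF x] by (intro bexI[of _ "coord N (inv x)"]) simp_all
    qed
  qed
  from closed assoc unit inverse mem[OF one_closed] show ?thesis
  proof eventually_elim
    case (elim N)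
    then show ?case by (intro groupI) simp_all
  qed
qed

lemma coord_inv:
  assumes x: "x \<in> carrier G"
  shows "\<forall>\<^sub>F N in U. inv\<^bsub>slice_group N\<^esub> (coord N x) = coord N (inv x)"
  using group_slice_group coord_mult[OF inv_closed[OF x] x]
    coord_in_slice[OF definable_carrier x] coord_in_slice[OF definable_carrier inv_closed[OF x]]
proof eventually_elim
  case (elim N)
  interpret S: group "slice_group N" by fact
  show ?case using elim l_inv[OF x] by (intro S.inv_equality) simp_all
qed

lemma coord_inv_mult:
  assumes x: "x \<in> carrier G" and y: "y \<in> carrier G"
  shows "\<forall>\<^sub>F N in U. inv\<^bsub>slice_group N\<^esub> (coord N x) \<otimes>\<^bsub>slice_group N\<^esub> coord N y = coord N (inv x \<otimes> y)"
  using coord_inv[OF x] coord_mult[OF inv_closed[OF x] y] by eventually_elim simp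

section \<open>Negligible sets\<close>

definition slice_order :: "('f, 'p, 'a) struct \<Rightarrow> real" where
  "slice_order N = real (card (slice n (carrier G) N))"

lemma finite_carrier_slice: "\<forall>\<^sub>F N in U. finite (carrier (slice_group N)) \<and> slice_order N > 0"
  using eventually_in_class slice_nonempty[OF definable_carrier one_closed]
  by eventually_elim (simp add: finite_slice[OF definable_carrier] slice_order_def card_gt_0_iff)

lemma slice_mono:
  assumes "definable L M n X" "definable L M n Y" "X \<subseteq> Y"
  shows "\<forall>\<^sub>F N in U. slice n X N \<subseteq> slice n Y N"
proof -
  have "\<forall>\<^sub>F N in U. \<forall>x\<in>slice n X N. x \<in> slice n Y N"
    using assms coord_in_slice by (intro transfer_slice) auto
  then show ?thesis by eventually_elim blast
qed

lemma slice_card_mono: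
  assumes "definable L M n X" "definable L M n Y" "X \<subseteq> Y"
  shows "\<forall>\<^sub>F N in U. card (slice n X N) \<le> card (slice n Y N)"
  using slice_mono[OF assms] eventually_in_class
  by eventually_elim (rule card_mono[OF finite_slice[OF assms(2)]])

definition negligible :: "('f, 'p, 'a) ultra_elem set list set \<Rightarrow> bool" where
  "negligible X \<longleftrightarrow> (\<forall>\<epsilon>>0. \<forall>\<^sub>F N in U. real (card (slice n X N)) \<le> \<epsilon> * slice_order N)"

text \<open>The ultrafilter decides each inequality, so a failing upper bound turns into a lower
  bound in almost all factors. This form supplies the positive constants for the counting
  arguments.\<close>

lemma not_negligible_iff:
  "\<not> negligible X \<longleftrightarrow> (\<exists>\<epsilon>>0. \<forall>\<^sub>F N in U. real (card (slice n X N)) \<ge> \<epsilon> * slice_order N)"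
proof
  assume "\<not> negligible X"
  then obtain \<epsilon> where \<epsilon>: "\<epsilon> > 0" "\<not> (\<forall>\<^sub>F N in U. real (card (slice n X N)) \<le> \<epsilon> * slice_order N)"
    unfolding negligible_def by blast
  from not_eventually_iff[THEN iffD1, OF \<epsilon>(2)]
  have "\<forall>\<^sub>F N in U. real (card (slice n X N)) \<ge> \<epsilon> * slice_order N" by eventually_elim simp
  with \<epsilon>(1) show "\<exists>\<epsilon>>0. \<forall>\<^sub>F N in U. real (card (slice n X N)) \<ge> \<epsilon> * slice_order N" by blast
next
  assume "\<exists>\<epsilon>>0. \<forall>\<^sub>F N in U. real (card (slice n X N)) \<ge> \<epsilon> * slice_order N"
  then obtain \<epsilon> where \<epsilon>: "\<epsilon> > 0" "\<forall>\<^sub>F N in U. real (card (slice n X N)) \<ge> \<epsilon> * slice_order N" by blast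
  show "\<not> negligible X"
  proof
    assume "negligible X"
    then have "\<forall>\<^sub>F N in U. real (card (slice n X N)) \<le> (\<epsilon> / 2) * slice_order N"
      unfolding negligible_def using half_gt_zero[OF \<epsilon>(1)] by blast
    with \<epsilon>(2) finite_carrier_slice have "\<forall>\<^sub>F N in U. False"
    proof eventually_elim
      case (elim N)
      then have "\<epsilon> * slice_order N \<le> (\<epsilon> / 2) * slice_order N" by linarith
      then show ?case using elim \<epsilon>(1) by simp
    qed
    then show False using not_eventually_False by simp
  qed
qed

text \<open>The bridge between dimension and measure: a standard bound for |G| / |X| is the
  reciprocal of a standard positive lower bound for |X| / |G|.\<close>

lemma \<delta>_carrier_le_iff:
  assumes X: "definable L M n X"
  shows "\<delta> L \<C> U (carrier G) \<le> \<delta> L \<C> U X \<longleftrightarrow> \<not> negligible X"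
  unfolding \<delta>_le_iff[OF definable_carrier X] not_negligible_iff
proof
  assume "\<exists>c. \<forall>\<^sub>F N in U. real (card (slice n (carrier G) N)) \<le> c * real (card (slice n X N))"
  then obtain c where c: "\<forall>\<^sub>F N in U. slice_order N \<le> c * real (card (slice n X N))"
    unfolding slice_order_def by blast
  \<comment> \<open>\<open>max c 1\<close> gives a positive denominator whatever the sign of
    c.\<close>
  have "\<forall>\<^sub>F N in U. real (card (slice n X N)) \<ge> (1 / max c 1) * slice_order N"
    using c
  proof eventually_elim
    case (elim N)
    also have "c * real (card (slice n X N)) \<le> max c 1 * real (card (slice n X N))"
      by (intro mult_right_mono) auto
    finally show ?case by (simp add: field_simps)
  qed
  then show "\<exists>\<epsilon>>0. \<forall>\<^sub>F N in U. real (card (slice n X N)) \<ge> \<epsilon> * slice_order N"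
    by (intro exI[of _ "1 / max c 1"]) simp
next
  assume "\<exists>\<epsilon>>0. \<forall>\<^sub>F N in U. real (card (slice n X N)) \<ge> \<epsilon> * slice_order N"
  then obtain \<epsilon> where \<epsilon>: "\<epsilon> > 0" "\<forall>\<^sub>F N in U. real (card (slice n X N)) \<ge> \<epsilon> * slice_order N" by blast
  from \<epsilon>(2) have "\<forall>\<^sub>F N in U. real (card (slice n (carrier G) N)) \<le> (1 / \<epsilon>) * real (card (slice n X N))"
    by eventually_elim (use \<epsilon>(1) in \<open>simp add: slice_order_def field_simps\<close>)
  then show "\<exists>c. \<forall>\<^sub>F N in U. real (card (slice n (carrier G) N)) \<le> c * real (card (slice n X N))" ..
qed

text \<open>A pointwise positive lower bound is uniform: a minimiser chosen in every structure is
  itself a point of the ultraproduct.\<close>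

lemma uniform_lower_bound:
  fixes f :: "('f, 'p, 'a) struct \<Rightarrow> 'a list \<Rightarrow> real"
  assumes X: "definable L M n X"
    and f: "\<And>x. x \<in> X \<Longrightarrow> \<exists>\<epsilon>>0. \<forall>\<^sub>F N in U. f N (coord N x) \<ge> \<epsilon> * slice_order N"
  shows "\<exists>\<epsilon>>0. \<forall>\<^sub>F N in U. \<forall>x\<in>slice n X N. f N x \<ge> \<epsilon> * slice_order N"
proof (cases "X = {}")
  case True
  then have "\<forall>\<^sub>F N in U. slice n X N = {}" using slice_empty X by simp
  then have "\<forall>\<^sub>F N in U. \<forall>x\<in>slice n X N. f N x \<ge> 1 * slice_order N" by eventually_elim simp
  then show ?thesis using zero_less_one by blast
next
  case False
  then obtain x0 where x0: "x0 \<in> X" by blast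
  define m where "m N = arg_min_on (f N) (slice n X N)" for N
  have m: "\<forall>\<^sub>F N in U. m N \<in> slice n X N \<and> (\<forall>x\<in>slice n X N. f N (m N) \<le> f N x)"
    using slice_nonempty[OF X x0] eventually_in_class
  proof eventually_elim
    case (elim N)
    then show ?case unfolding m_def
      using arg_min_if_finite(1)[of "slice n X N" "f N"] arg_min_least[of "slice n X N" _ "f N"]
        finite_slice[OF X] by blast
  qed
  then have "\<forall>\<^sub>F N in U. m N \<in> nlists n (univ N)"
  proof eventually_elim
    case (elim N)
    then show ?case using slice_properties(2)[OF X, of N] by blast
  qed
  then obtain x where x: "x \<in> nlists n (univ M)" "\<forall>\<^sub>F N in U. coord N x = m N"
    using realize[of m n] by blast
  from m x(2) have "\<forall>\<^sub>F N in U. coord N x \<in> slice n X N" by eventually_elim simp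
  then have "x \<in> X" using in_definable_iff[OF X x(1)] by simp
  from f[OF this] obtain \<epsilon> where \<epsilon>: "\<epsilon> > 0" "\<forall>\<^sub>F N in U. f N (coord N x) \<ge> \<epsilon> * slice_order N" by blast
  from \<epsilon>(2) m x(2) have "\<forall>\<^sub>F N in U. \<forall>x\<in>slice n X N. f N x \<ge> \<epsilon> * slice_order N"
    by eventually_elim fastforce
  with \<epsilon>(1) show ?thesis by blast
qed

section \<open>Slices and fibres of factor sets and shift differences\<close>

lemma slice_factor_set:
  assumes P: "definable L M n P" "P \<subseteq> carrier G" and Q: "definable L M n Q"
    and g: "g \<in> carrier G" and F: "definable L M n (factor_set G P Q g)"
  shows "\<forall>\<^sub>F N in U. slice n (factor_set G P Q g) N
    = factor_set (slice_group N) (slice n P N) (slice n Q N) (coord N g)"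
proof (rule slice_unique[OF F])
  show "factor_set (slice_group N) (slice n P N) (slice n Q N) (coord N g) \<subseteq> nlists n (univ N)" for N
    using slice_properties(2)[OF P(1), of N] unfolding factor_set_def by blast
  have "x \<in> factor_set G P Q g
      \<longleftrightarrow> (\<forall>\<^sub>F N in U. coord N x \<in> factor_set (slice_group N) (slice n P N) (slice n Q N) (coord N g))"
    if x: "x \<in> nlists n (univ M)" for x
  \<comment> \<open>Inverses are controlled only on the group, so membership in P is decided
    first.\<close>
  proof (cases "x \<in> P")
    case True
    then have xG: "x \<in> carrier G" using P(2) by blast
    have "inv x \<otimes> g \<in> nlists n (univ M)" using xG g by (intro carrier_subset) simp
    then have "inv x \<otimes> g \<in> Q \<longleftrightarrow> (\<forall>\<^sub>F N in U. coord N (inv x \<otimes> g) \<in> slice n Q N)"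
      by (rule in_definable_iff[OF Q])
    also have "\<dots> \<longleftrightarrow> (\<forall>\<^sub>F N in U. coord N x \<in> factor_set (slice_group N) (slice n P N) (slice n Q N) (coord N g))"
    proof (rule eventually_subst)
      show "\<forall>\<^sub>F N in U. coord N (inv x \<otimes> g) \<in> slice n Q N
        \<longleftrightarrow> coord N x \<in> factor_set (slice_group N) (slice n P N) (slice n Q N) (coord N g)"
        using coord_inv_mult[OF xG g] coord_in_slice[OF P(1) True]
        by eventually_elim (simp add: factor_set_def)
    qed
    finally show ?thesis using True unfolding factor_set_def by simp
  next
    case False
    then show ?thesis using in_definable_iff[OF P(1) x] unfolding factor_set_def
      by (auto simp: eventually_conj_iff)
  qed
  then show "factor_set G P Q g = ultraset n
      (\<lambda>N. factor_set (slice_group N) (slice n P N) (slice n Q N) (coord N g))"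
    using P(2) carrier_subset unfolding ultraset_def factor_set_def by blast
qed

lemma slice_shift_diff:
  assumes T: "definable L M n T" "T \<subseteq> carrier G"
    and h: "h \<in> carrier G" and F: "definable L M n (shift_diff G T h)"
  shows "\<forall>\<^sub>F N in U. slice n (shift_diff G T h) N = shift_diff (slice_group N) (slice n T N) (coord N h)"
proof (rule slice_unique[OF F])
  show "shift_diff (slice_group N) (slice n T N) (coord N h) \<subseteq> nlists n (univ N)" for N
    using slice_properties(2)[OF T(1), of N] unfolding shift_diff_def by blast
  have "x \<in> shift_diff G T h
      \<longleftrightarrow> (\<forall>\<^sub>F N in U. coord N x \<in> shift_diff (slice_group N) (slice n T N) (coord N h))"
    if x: "x \<in> nlists n (univ M)" for x
  proof (cases "x \<in> T")
    case True
    then have xG: "x \<in> carrier G" using T(2) by blast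
    have "inv h \<otimes> x \<in> nlists n (univ M)" using xG h by (intro carrier_subset) simp
    then have "inv h \<otimes> x \<notin> T \<longleftrightarrow> (\<forall>\<^sub>F N in U. coord N (inv h \<otimes> x) \<notin> slice n T N)"
      using in_definable_iff[OF T(1)] not_eventually_iff by simp
    also have "\<dots> \<longleftrightarrow> (\<forall>\<^sub>F N in U. coord N x \<in> shift_diff (slice_group N) (slice n T N) (coord N h))"
    proof (rule eventually_subst)
      show "\<forall>\<^sub>F N in U. coord N (inv h \<otimes> x) \<notin> slice n T N
        \<longleftrightarrow> coord N x \<in> shift_diff (slice_group N) (slice n T N) (coord N h)"
        using coord_inv_mult[OF h xG] coord_in_slice[OF T(1) True]
        by eventually_elim (simp add: shift_diff_def)
    qed
    finally show ?thesis using True unfolding shift_diff_def by simp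
  next
    case False
    then show ?thesis using in_definable_iff[OF T(1) x] unfolding shift_diff_def
      by (auto simp: eventually_conj_iff)
  qed
  then show "shift_diff G T h = ultraset n (\<lambda>N. shift_diff (slice_group N) (slice n T N) (coord N h))"
    using T(2) carrier_subset unfolding ultraset_def shift_diff_def by blast
qed

lemma fibre_append:
  assumes "P \<subseteq> nlists n (univ M)" "z \<in> nlists n (univ M)"
  shows "{x \<in> nlists n (univ M). x @ z \<in> {x @ z | x z. x \<in> P \<and> z \<in> nlists n (univ M) \<and> E x z}}
    = {x \<in> P. E x z}"
    (is "?A = ?B")
proof (rule Set.set_eqI, rule iffI)
  fix x assume "x \<in> ?A"
  then have x: "x \<in> nlists n (univ M)"
    and "\<exists>x' z'. x @ z = x' @ z' \<and> x' \<in> P \<and> z' \<in> nlists n (univ M) \<and> E x' z'"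
    unfolding mem_Collect_eq by (rule conjunct1, rule conjunct2)
  then obtain x' z' where *: "x @ z = x' @ z'" "x' \<in> P" "E x' z'" by (elim exE conjE)
  have "length x = length x'"
    using nlistsE_length[OF x] nlistsE_length[OF subsetD[OF assms(1) *(2)]] by (rule trans[OF _ sym])
  then have "x = x'" "z = z'" using *(1) by simp_all
  then show "x \<in> ?B" using * by simp
next
  fix x assume "x \<in> ?B"
  then have x: "x \<in> P" "E x z" by simp_all
  then show "x \<in> ?A" unfolding mem_Collect_eq
    by (intro conjI exI[of _ x] exI[of _ z] refl assms(2) subsetD[OF assms(1)])
qed

text \<open>The witness y of the relation is forced to be x^-1 g.\<close>

lemma fibre_factor_set:
  assumes P: "P \<subseteq> carrier G" and Q: "Q \<subseteq> carrier G" and g: "g \<in> carrier G"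
  shows "{x \<in> nlists n (univ M). x @ g \<in> {x @ z | x z. x \<in> P \<and> z \<in> nlists n (univ M)
    \<and> (\<exists>y\<in>Q. x @ y @ z \<in> graph)}} = factor_set G P Q g"
proof -
  have "(\<exists>y\<in>Q. x @ y @ g \<in> graph) \<longleftrightarrow> inv x \<otimes> g \<in> Q" if x: "x \<in> P" for x
  proof -
    have xG: "x \<in> carrier G" using x P by blast
    have "x @ y @ g \<in> graph \<longleftrightarrow> y = inv x \<otimes> g" if "y \<in> Q" for y
      using that Q xG g in_graph_iff[of x y g] carrier_subset
      by (auto simp: inv_mult_cancel1 inv_mult_cancel2)
    then show ?thesis by blast
  qed
  moreover have "P \<subseteq> nlists n (univ M)" using P carrier_subset by blast
  ultimately show ?thesis
    using fibre_append[OF _ carrier_subset[OF g], of P "\<lambda>x z. \<exists>y\<in>Q. x @ y @ z \<in> graph"]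
    unfolding factor_set_def by auto
qed

lemma fibre_shift_diff:
  assumes T: "T \<subseteq> carrier G" and h: "h \<in> carrier G"
  shows "{x \<in> nlists n (univ M). x @ h \<in> {x @ z | x z. x \<in> T \<and> z \<in> nlists n (univ M)
    \<and> (\<exists>y\<in>carrier G - T. z @ y @ x \<in> graph)}} = shift_diff G T h"
proof -
  have "(\<exists>y\<in>carrier G - T. h @ y @ x \<in> graph) \<longleftrightarrow> inv h \<otimes> x \<notin> T" if x: "x \<in> T" for x
  proof -
    have xG: "x \<in> carrier G" using x T by blast
    have "h @ y @ x \<in> graph \<longleftrightarrow> y = inv h \<otimes> x" if "y \<in> carrier G" for y
      using that xG h in_graph_iff[of h y x] carrier_subset
      by (auto simp: inv_mult_cancel1 inv_mult_cancel2)
    then show ?thesis using xG h by auto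
  qed
  moreover have "T \<subseteq> nlists n (univ M)" using T carrier_subset by blast
  ultimately show ?thesis
    using fibre_append[OF _ carrier_subset[OF h], of T "\<lambda>x z. \<exists>y\<in>carrier G - T. z @ y @ x \<in> graph"]
    unfolding shift_diff_def by auto
qed

lemma definable_factor_set:
  assumes "definable L M n P" "P \<subseteq> carrier G" "definable L M n Q" "Q \<subseteq> carrier G" "g \<in> carrier G"
  shows "definable L M n (factor_set G P Q g)"
  using definable_fibre[OF definable_factor_relation(1)[OF definable_graph assms(1,3)] carrier_subset[OF assms(5)]]
  unfolding fibre_factor_set[OF assms(2,4,5)] .

lemma definable_shift_diff:
  assumes T: "definable L M n T" "T \<subseteq> carrier G" and h: "h \<in> carrier G"
  shows "definable L M n (shift_diff G T h)"
  using definable_fibre[OF definable_factor_relation(2)[OF definable_graph T(1)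
        definable_Diff[OF definable_carrier T(1)]] carrier_subset[OF h]]
  unfolding fibre_shift_diff[OF T(2) h] .

text \<open>Negligibility refers to all standard \<epsilon> and is not given by a formula; it
  becomes one as the failure of \<delta>(G) \<le> \<delta>(fibre). Dimension comparison enters the
  argument through this lemma.\<close>

lemma definable_negligible_fibres:
  assumes DC: "dimension_comparison L \<C> U" and Z: "definable L M (n + n) Z"
  shows "definable L M n {g \<in> carrier G. negligible {x \<in> nlists n (univ M). x @ g \<in> Z}}"
proof -
  have "{g \<in> carrier G. negligible {x \<in> nlists n (univ M). x @ g \<in> Z}}
    = carrier G - {g \<in> nlists n (univ M). \<delta> L \<C> U (carrier G) \<le> \<delta> L \<C> U {x \<in> nlists n (univ M). x @ g \<in> Z}}"
    using \<delta>_carrier_le_iff[OF definable_fibre[OF Z]] carrier_subset by blast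
  then show ?thesis
    using definable_Diff[OF definable_carrier definable_\<delta>_le[OF DC definable_carrier Z]] by simp
qed

section \<open>The null factors, which form the set T, and the stabilizer of T\<close>

definition null_factors :: "('f, 'p, 'a) ultra_elem set list set \<Rightarrow> ('f, 'p, 'a) ultra_elem set list set
    \<Rightarrow> ('f, 'p, 'a) ultra_elem set list set" where
  "null_factors P Q = {g \<in> carrier G. negligible (factor_set G P Q g)}"

definition null_stabilizer :: "('f, 'p, 'a) ultra_elem set list set \<Rightarrow> ('f, 'p, 'a) ultra_elem set list set" where
  "null_stabilizer T = {h \<in> carrier G. negligible (shift_diff G T h)}"

lemma definable_null_factors:
  assumes "dimension_comparison L \<C> U"
    and "definable L M n P" "P \<subseteq> carrier G" "definable L M n Q" "Q \<subseteq> carrier G"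
  shows "definable L M n (null_factors P Q)"
proof -
  let ?Z = "{x @ z | x z. x \<in> P \<and> z \<in> nlists n (univ M) \<and> (\<exists>y\<in>Q. x @ y @ z \<in> graph)}"
  have "null_factors P Q = {g \<in> carrier G. negligible {x \<in> nlists n (univ M). x @ g \<in> ?Z}}"
    unfolding null_factors_def
    by (intro Collect_cong conj_cong refl arg_cong[of _ _ negligible] fibre_factor_set[symmetric] assms)
  then show ?thesis
    using definable_negligible_fibres[OF assms(1) definable_factor_relation(1)[OF definable_graph assms(2,4)]]
    by (rule ssubst)
qed

lemma definable_null_stabilizer:
  assumes "dimension_comparison L \<C> U" and T: "definable L M n T" "T \<subseteq> carrier G"
  shows "definable L M n (null_stabilizer T)"
proof -
  let ?Z = "{x @ z | x z. x \<in> T \<and> z \<in> nlists n (univ M) \<and> (\<exists>y\<in>carrier G - T. z @ y @ x \<in> graph)}"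
  have "null_stabilizer T = {h \<in> carrier G. negligible {x \<in> nlists n (univ M). x @ h \<in> ?Z}}"
    unfolding null_stabilizer_def
    by (intro Collect_cong conj_cong refl arg_cong[of _ _ negligible] fibre_shift_diff[symmetric] T)
  then show ?thesis
    using definable_negligible_fibres[OF assms(1) definable_factor_relation(2)[OF definable_graph T(1)
        definable_Diff[OF definable_carrier T(1)]]]
    by (rule ssubst)
qed

text \<open>The estimates are moved from the slice of the factor set to the factor set of the
  slices, where counting in a finite group applies.\<close>

lemma negligible_factor_set_iff:
  assumes "definable L M n P" "P \<subseteq> carrier G" "definable L M n Q" "Q \<subseteq> carrier G" "g \<in> carrier G"
  shows "negligible (factor_set G P Q g) \<longleftrightarrow> (\<forall>\<epsilon>>0. \<forall>\<^sub>F N in U.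
    real (card (factor_set (slice_group N) (slice n P N) (slice n Q N) (coord N g))) \<le> \<epsilon> * slice_order N)"
    (is ?A)
  and "\<not> negligible (factor_set G P Q g) \<longleftrightarrow> (\<exists>\<epsilon>>0. \<forall>\<^sub>F N in U.
    real (card (factor_set (slice_group N) (slice n P N) (slice n Q N) (coord N g))) \<ge> \<epsilon> * slice_order N)"
    (is ?B)
proof -
  have ev: "\<forall>\<^sub>F N in U. slice n (factor_set G P Q g) N
    = factor_set (slice_group N) (slice n P N) (slice n Q N) (coord N g)"
    by (rule slice_factor_set[OF assms(1,2,3,5) definable_factor_set[OF assms]])
  have le: "(\<forall>\<^sub>F N in U. real (card (slice n (factor_set G P Q g) N)) \<le> \<epsilon> * slice_order N) \<longleftrightarrow>
     (\<forall>\<^sub>F N in U. real (card (factor_set (slice_group N) (slice n P N) (slice n Q N) (coord N g))) \<le> \<epsilon> * slice_order N)" for \<epsilon>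
    by (rule eventually_subst, rule eventually_mono[OF ev]) simp
  have ge: "(\<forall>\<^sub>F N in U. real (card (slice n (factor_set G P Q g) N)) \<ge> \<epsilon> * slice_order N) \<longleftrightarrow>
     (\<forall>\<^sub>F N in U. real (card (factor_set (slice_group N) (slice n P N) (slice n Q N) (coord N g))) \<ge> \<epsilon> * slice_order N)" for \<epsilon>
    by (rule eventually_subst, rule eventually_mono[OF ev]) simp
  show ?A unfolding negligible_def le ..
  show ?B unfolding not_negligible_iff ge ..
qed

lemma negligible_shift_diff_iff:
  assumes T: "definable L M n T" "T \<subseteq> carrier G" and h: "h \<in> carrier G"
  shows "negligible (shift_diff G T h) \<longleftrightarrow> (\<forall>\<epsilon>>0. \<forall>\<^sub>F N in U.
    real (card (shift_diff (slice_group N) (slice n T N) (coord N h))) \<le> \<epsilon> * slice_order N)"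
    (is ?A)
  and "\<not> negligible (shift_diff G T h) \<longleftrightarrow> (\<exists>\<epsilon>>0. \<forall>\<^sub>F N in U.
    real (card (shift_diff (slice_group N) (slice n T N) (coord N h))) \<ge> \<epsilon> * slice_order N)"
    (is ?B)
proof -
  have ev: "\<forall>\<^sub>F N in U. slice n (shift_diff G T h) N
    = shift_diff (slice_group N) (slice n T N) (coord N h)"
    by (rule slice_shift_diff[OF T h definable_shift_diff[OF T h]])
  have le: "(\<forall>\<^sub>F N in U. real (card (slice n (shift_diff G T h) N)) \<le> \<epsilon> * slice_order N) \<longleftrightarrow>
     (\<forall>\<^sub>F N in U. real (card (shift_diff (slice_group N) (slice n T N) (coord N h))) \<le> \<epsilon> * slice_order N)" for \<epsilon>
    by (rule eventually_subst, rule eventually_mono[OF ev]) simp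
  have ge: "(\<forall>\<^sub>F N in U. real (card (slice n (shift_diff G T h) N)) \<ge> \<epsilon> * slice_order N) \<longleftrightarrow>
     (\<forall>\<^sub>F N in U. real (card (shift_diff (slice_group N) (slice n T N) (coord N h))) \<ge> \<epsilon> * slice_order N)" for \<epsilon>
    by (rule eventually_subst, rule eventually_mono[OF ev]) simp
  show ?A unfolding negligible_def le ..
  show ?B unfolding not_negligible_iff ge ..
qed

lemma eventually_slice_subset_carrier:
  assumes "definable L M n X" "X \<subseteq> carrier G"
  shows "\<forall>\<^sub>F N in U. slice n X N \<subseteq> carrier (slice_group N)"
  using slice_mono[OF assms(1) definable_carrier assms(2)] by simp

lemma slice_Diff:
  assumes X: "definable L M n X" and Y: "definable L M n Y"
  shows "\<forall>\<^sub>F N in U. slice n (X - Y) N = slice n X N - slice n Y N"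
proof (rule slice_unique[OF definable_Diff[OF X Y]])
  show "slice n X N - slice n Y N \<subseteq> nlists n (univ N)" for N
    using slice_properties(2)[OF X, of N] by blast
  have "x \<in> X - Y \<longleftrightarrow> (\<forall>\<^sub>F N in U. coord N x \<in> slice n X N - slice n Y N)"
    if "x \<in> nlists n (univ M)" for x
    unfolding Diff_iff in_definable_iff[OF X that] in_definable_iff[OF Y that]
      eventually_conj_iff not_eventually_iff ..
  then show "X - Y = ultraset n (\<lambda>N. slice n X N - slice n Y N)"
    using definable_subset[OF X] unfolding ultraset_def by blast
qed

text \<open>In each finite group |T - hT| is symmetric and subadditive in h, so the h for which it
  is infinitesimal relative to |G| are closed under inverses and products.\<close>

lemma subgroup_null_stabilizer:
  assumes T: "definable L M n T" "T \<subseteq> carrier G"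
  shows "subgroup (null_stabilizer T) G"
proof (rule subgroupI)
  note iff = negligible_shift_diff_iff(1)[OF T]
  note base = group_slice_group finite_carrier_slice eventually_slice_subset_carrier[OF T]
  note mem = coord_in_slice[OF definable_carrier]
  show "null_stabilizer T \<subseteq> carrier G" unfolding null_stabilizer_def by blast
  have "shift_diff G T \<one> = {}" unfolding shift_diff_def using T(2) by auto
  moreover have "definable L M n (shift_diff G T \<one>)" by (rule definable_shift_diff[OF T one_closed])
  ultimately have "\<forall>\<^sub>F N in U. slice n (shift_diff G T \<one>) N = {}" using slice_empty by simp
  with finite_carrier_slice have "\<forall>\<^sub>F N in U. real (card (slice n (shift_diff G T \<one>) N)) \<le> \<epsilon> * slice_order N"
    if "\<epsilon> > 0" for \<epsilon> by eventually_elim (use that in simp)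
  then have "\<one> \<in> null_stabilizer T" unfolding null_stabilizer_def negligible_def by simp
  then show "null_stabilizer T \<noteq> {}" by blast
  show "inv h \<in> null_stabilizer T" if h: "h \<in> null_stabilizer T" for h
  proof -
    have hG: "h \<in> carrier G" using h unfolding null_stabilizer_def by blast
    have "\<forall>\<^sub>F N in U. real (card (shift_diff (slice_group N) (slice n T N) (coord N (inv h)))) \<le> \<epsilon> * slice_order N"
      if "\<epsilon> > 0" for \<epsilon>
    proof -
      have "\<forall>\<^sub>F N in U. real (card (shift_diff (slice_group N) (slice n T N) (coord N h))) \<le> \<epsilon> * slice_order N"
        using h that iff[OF hG] unfolding null_stabilizer_def by blast
      with base mem[OF hG] coord_inv[OF hG] show ?thesis
      proof eventually_elim
        case (elim N)
        then show ?case using group.card_shift_diff_inv[of "slice_group N" "slice n T N" "coord N h"] by simp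
      qed
    qed
    then show ?thesis using hG iff[of "inv h"] unfolding null_stabilizer_def by simp
  qed
  show "h \<otimes> k \<in> null_stabilizer T" if h: "h \<in> null_stabilizer T" and k: "k \<in> null_stabilizer T" for h k
  proof -
    have hG: "h \<in> carrier G" and kG: "k \<in> carrier G"
      using h k unfolding null_stabilizer_def by blast+
    have "\<forall>\<^sub>F N in U. real (card (shift_diff (slice_group N) (slice n T N) (coord N (h \<otimes> k)))) \<le> \<epsilon> * slice_order N"
      if \<epsilon>: "\<epsilon> > 0" for \<epsilon>
    proof -
      have "\<forall>\<^sub>F N in U. real (card (shift_diff (slice_group N) (slice n T N) (coord N x))) \<le> (\<epsilon> / 2) * slice_order N"
        if "x \<in> null_stabilizer T" for x
        using that iff[of x] half_gt_zero[OF \<epsilon>] unfolding null_stabilizer_def by blast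
      from base mem[OF hG] mem[OF kG] coord_mult[OF hG kG] this[OF h] this[OF k]
      show ?thesis
      proof eventually_elim
        case (elim N)
        then have "card (shift_diff (slice_group N) (slice n T N) (coord N (h \<otimes> k)))
          \<le> card (shift_diff (slice_group N) (slice n T N) (coord N h))
            + card (shift_diff (slice_group N) (slice n T N) (coord N k))"
          using group.card_shift_diff_mult[of "slice_group N" "slice n T N" "coord N h" "coord N k"] by simp
        then show ?case using elim by linarith
      qed
    qed
    then show ?thesis using hG kG iff[of "h \<otimes> k"] unfolding null_stabilizer_def by simp
  qed
qed

text \<open>Infinitely many cosets would give, for every m, m elements whose quotients avoid the
  stabilizer. Off the stabilizer |T - hT| has a uniform standard lower bound, so in a suitable
  factor the translates of T by these elements are separated. The separation bound on their number
  depends only on \<epsilon>' and J.\<close>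

lemma null_stabilizer_finite_index:
  assumes DC: "dimension_comparison L \<C> U"
    and P: "definable L M n P" "P \<subseteq> carrier G" and Q: "definable L M n Q" "Q \<subseteq> carrier G"
  defines "T \<equiv> null_factors P Q"
  shows "finite (rcosets (null_stabilizer T))"
proof (rule ccontr)
  assume infinite: "infinite (rcosets (null_stabilizer T))"
  let ?H = "null_stabilizer T"
  let ?f = "\<lambda>N. factor_set (slice_group N) (slice n P N) (slice n Q N)"
  let ?s = "\<lambda>N. shift_diff (slice_group N) (slice n T N)"
  have T: "definable L M n T" "T \<subseteq> carrier G"
    using definable_null_factors[OF DC P Q] unfolding T_def null_factors_def by auto
  have dH: "definable L M n ?H" by (rule definable_null_stabilizer[OF DC T])
  interpret H: subgroup ?H G by (rule subgroup_null_stabilizer[OF T])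
  have "\<exists>\<epsilon>>0. \<forall>\<^sub>F N in U. \<forall>g\<in>slice n (carrier G - T) N. real (card (?f N g)) \<ge> \<epsilon> * slice_order N"
  proof (rule uniform_lower_bound[OF definable_Diff[OF definable_carrier T(1)]])
    fix g assume "g \<in> carrier G - T"
    then have "g \<in> carrier G" "\<not> negligible (factor_set G P Q g)"
      unfolding T_def null_factors_def by auto
    then show "\<exists>\<epsilon>>0. \<forall>\<^sub>F N in U. real (card (?f N (coord N g))) \<ge> \<epsilon> * slice_order N"
      using negligible_factor_set_iff(2)[OF P Q] by blast
  qed
  then obtain \<epsilon>0 where \<epsilon>0: "\<epsilon>0 > 0"
    "\<forall>\<^sub>F N in U. \<forall>g\<in>slice n (carrier G - T) N. real (card (?f N g)) \<ge> \<epsilon>0 * slice_order N" by blast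
  \<comment> \<open>Halved because the separation bound asks for 2\<epsilon> off T.\<close>
  define \<epsilon> where "\<epsilon> = \<epsilon>0 / 2"
  have \<epsilon>: "\<epsilon> > 0" "\<epsilon>0 = 2 * \<epsilon>" using \<epsilon>0 unfolding \<epsilon>_def by auto
  obtain J :: nat where J: "real J * \<epsilon> > 1" using reals_Archimedean3[OF \<epsilon>(1)] by blast
  have Jpos: "J > 0" using J by (cases J) auto
  \<comment> \<open>On T every standard bound is available, so this one may depend on J.\<close>
  define \<eta> where "\<eta> = \<epsilon> / real J"
  have \<eta>: "\<eta> > 0" "real J * \<eta> \<le> \<epsilon>" using \<epsilon> Jpos unfolding \<eta>_def by auto
  have small: "\<forall>\<^sub>F N in U. \<forall>g\<in>slice n T N. real (card (?f N g)) \<le> \<eta> * slice_order N"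
  proof (rule transfer_slice[OF T(1)])
    fix g assume "g \<in> T"
    then have "g \<in> carrier G" "negligible (factor_set G P Q g)"
      unfolding T_def null_factors_def by auto
    then show "\<forall>\<^sub>F N in U. real (card (factor_set (slice_group N) (slice n P N) (slice n Q N) (coord N g)))
        \<le> \<eta> * slice_order N"
      using negligible_factor_set_iff(1)[OF P Q] \<eta>(1) by blast
  qed
  have "\<exists>\<epsilon>'>0. \<forall>\<^sub>F N in U. \<forall>h\<in>slice n (carrier G - ?H) N. real (card (?s N h)) \<ge> \<epsilon>' * slice_order N"
  proof (rule uniform_lower_bound[OF definable_Diff[OF definable_carrier dH]])
    fix h assume "h \<in> carrier G - ?H"
    then have "h \<in> carrier G" "\<not> negligible (shift_diff G T h)"
      unfolding null_stabilizer_def by auto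
    then show "\<exists>\<epsilon>>0. \<forall>\<^sub>F N in U. real (card (?s N (coord N h))) \<ge> \<epsilon> * slice_order N"
      using negligible_shift_diff_iff(2)[OF T] by blast
  qed
  then obtain \<epsilon>1 where \<epsilon>1: "\<epsilon>1 > 0"
    "\<forall>\<^sub>F N in U. \<forall>h\<in>slice n (carrier G - ?H) N. real (card (?s N h)) \<ge> \<epsilon>1 * slice_order N" by blast
  \<comment> \<open>Capped at 1 so that the powers of \<epsilon>' decrease.\<close>
  define \<epsilon>' where "\<epsilon>' = min \<epsilon>1 1"
  have \<epsilon>': "0 < \<epsilon>'" "\<epsilon>' \<le> 1" "\<epsilon>' \<le> \<epsilon>1" using \<epsilon>1 unfolding \<epsilon>'_def by auto
  have "\<epsilon>' ^ J > 0" using \<epsilon>' by simp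
  then obtain m :: nat where m: "real m * \<epsilon>' ^ J > 2" using reals_Archimedean3 by blast
  \<comment> \<open>\<open>m\<close> is fixed before any factor is chosen, and only finitely many
    cosets are taken, so the conditions on all their pairs hold together in almost all
    factors.\<close>
  obtain R where R: "R \<subseteq> rcosets ?H" "finite R" "card R = m"
    using infinite_arbitrarily_large[OF infinite] by blast
  have "\<exists>a. a \<in> carrier G \<and> c = ?H #> a" if "c \<in> R" for c
    using R(1) that unfolding RCOSETS_def by blast
  then obtain a where a: "\<And>c. c \<in> R \<Longrightarrow> a c \<in> carrier G" "\<And>c. c \<in> R \<Longrightarrow> c = ?H #> a c" by metis
  have sep: "a c \<otimes> inv (a d) \<in> carrier G - ?H" if cd: "c \<in> R" "d \<in> R" "c \<noteq> d" for c d
  proof -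
    have "a c \<otimes> inv (a d) \<notin> ?H"
    proof
      assume "a c \<otimes> inv (a d) \<in> ?H"
      moreover have "(a c \<otimes> inv (a d)) \<otimes> a d = a c" using a cd by (simp add: m_assoc)
      ultimately have "a c \<in> ?H #> a d" unfolding r_coset_def by force
      then have "?H #> a d = ?H #> a c"
        using repr_independence[OF _ a(1)[OF cd(2)] H.subgroup_axioms] by blast
      then show False using a cd by metis
    qed
    then show ?thesis using a cd by simp
  qed
  \<comment> \<open>The cosets are right cosets, while the separation bound speaks of left
    translates. Inverting the representatives turns a quotient
    \<open>a c \<otimes> inv (a d)\<close> into \<open>inv (b c) \<otimes> b d\<close>.\<close>
  define b where "b c = inv (a c)" for c
  have b: "b c \<in> carrier G" if "c \<in> R" for c using a that unfolding b_def by simp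
  have sep': "inv (b c) \<otimes> b d \<in> carrier G - ?H" if cd: "c \<in> R" "d \<in> R" "c \<noteq> d" for c d
    using sep[OF cd] a cd unfolding b_def by simp
  have pair: "\<forall>\<^sub>F N in U. c \<noteq> d \<longrightarrow> real (card (?s N (inv\<^bsub>slice_group N\<^esub> (coord N (b c))
      \<otimes>\<^bsub>slice_group N\<^esub> coord N (b d)))) \<ge> \<epsilon>' * slice_order N" if cd: "c \<in> R" "d \<in> R" for c d
  proof (cases "c = d")
    case False
    have "\<forall>\<^sub>F N in U. coord N (inv (b c) \<otimes> b d) \<in> slice n (carrier G - ?H) N"
      by (rule coord_in_slice[OF definable_Diff[OF definable_carrier dH] sep'[OF cd False]])
    with \<epsilon>1(2) coord_inv_mult[OF b[OF cd(1)] b[OF cd(2)]] finite_carrier_slice show ?thesis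
    proof eventually_elim
      case (elim N)
      have "\<epsilon>' * slice_order N \<le> \<epsilon>1 * slice_order N"
        using \<epsilon>' elim(3) by (intro mult_right_mono) auto
      also have "\<dots> \<le> real (card (?s N (coord N (inv (b c) \<otimes> b d))))"
        using elim(1,4) by (rule bspec)
      finally show ?case unfolding elim(2) by simp
    qed
  qed simp
  have "\<forall>\<^sub>F N in U. \<forall>c\<in>R. \<forall>d\<in>R. c \<noteq> d \<longrightarrow> real (card (?s N (inv\<^bsub>slice_group N\<^esub> (coord N (b c))
      \<otimes>\<^bsub>slice_group N\<^esub> coord N (b d)))) \<ge> \<epsilon>' * slice_order N"
    by (intro eventually_ball_finite[OF R(2)] ballI pair)
  moreover have "\<forall>\<^sub>F N in U. \<forall>c\<in>R. coord N (b c) \<in> slice n (carrier G) N"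
    by (intro eventually_ball_finite[OF R(2)] ballI coord_in_slice[OF definable_carrier b])
  moreover note small \<epsilon>0(2) group_slice_group finite_carrier_slice slice_Diff[OF definable_carrier T(1)]
    eventually_slice_subset_carrier[OF T] eventually_slice_subset_carrier[OF P]
    eventually_slice_subset_carrier[OF Q]
  ultimately have "\<forall>\<^sub>F N in U. False"
  proof eventually_elim
    case (elim N)
    interpret S: group "slice_group N" by fact
    let ?S = "(\<lambda>c. coord N (b c)) ` R"
    have order: "real (card (carrier (slice_group N))) = slice_order N" unfolding slice_order_def by simp
    \<comment> \<open>If the coordinates of two distinct representatives collided, the shift
      difference at the unit would be empty and yet have at least \<epsilon>' |G| > 0
      elements.\<close>
    have inj: "inj_on (\<lambda>c. coord N (b c)) R"
    proof (rule inj_onI, rule ccontr)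
      fix c d assume cd: "c \<in> R" "d \<in> R" "coord N (b c) = coord N (b d)" "c \<noteq> d"
      have "coord N (b d) \<in> carrier (slice_group N)" using elim(2) cd by simp
      then have "inv\<^bsub>slice_group N\<^esub> (coord N (b c)) \<otimes>\<^bsub>slice_group N\<^esub> coord N (b d) = \<one>\<^bsub>slice_group N\<^esub>"
        using cd(3) S.l_inv by metis
      moreover have "?s N \<one>\<^bsub>slice_group N\<^esub> = {}"
        unfolding shift_diff_def using elim(8) S.inv_one S.l_one by auto
      ultimately have "real (card ({} :: 'a list set)) \<ge> \<epsilon>' * slice_order N" using elim(1) cd by metis
      moreover have "\<epsilon>' * slice_order N > 0" using \<epsilon>' elim(6) by simp
      ultimately show False by simp
    qed
    have "real (card ?S) * \<epsilon>' ^ J < 2"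
    proof (rule S.shift_separated_bound[where P = "slice n P N" and Q = "slice n Q N"
          and T = "slice n T N" and \<eta> = \<eta> and \<epsilon> = \<epsilon>])
      show "?S \<subseteq> carrier (slice_group N)" using elim(2) by auto
      show "real (card (?f N g)) \<le> \<eta> * real (card (carrier (slice_group N)))" if "g \<in> slice n T N" for g
        using elim(3) that unfolding order by blast
      show "2 * \<epsilon> * real (card (carrier (slice_group N))) \<le> real (card (?f N g))"
        if "g \<in> carrier (slice_group N) - slice n T N" for g
        using elim(4,7) that unfolding order \<epsilon>(2) by auto
      show "\<epsilon>' * real (card (carrier (slice_group N)))
          \<le> real (card (?s N (inv\<^bsub>slice_group N\<^esub> h \<otimes>\<^bsub>slice_group N\<^esub> k)))"
        if hk: "h \<in> ?S" "k \<in> ?S" "h \<noteq> k" for h k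
      proof -
        obtain c d where cd: "c \<in> R" "h = coord N (b c)" "d \<in> R" "k = coord N (b d)"
          using hk(1,2) by (elim imageE)
        then have "c \<noteq> d" using hk(3) by auto
        with elim(1) cd show ?thesis unfolding order by simp
      qed
      show "0 \<le> \<eta>" using \<eta>(1) by simp
      show "finite (carrier (slice_group N))" using elim(6) by simp
    qed (fact elim(8) elim(9) elim(10) \<epsilon>'(1) \<epsilon>'(2) \<eta>(2) J)+
    then show ?case using m card_image[OF inj] R(3) by simp
  qed
  then show False using not_eventually_False by simp
qed

text \<open>The stabilizer is all of G, so all translates of T agree with T up to null sets. If T
  were not null, averaging would make its complement small; then nearly every g would have few
  factorisations, against the total number |P| |Q|.\<close>

lemma negligible_null_factors:
  assumes DC: "dimension_comparison L \<C> U"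
    and connected: "\<And>H. subgroup H G \<Longrightarrow> definable L M n H \<Longrightarrow> finite (rcosets H) \<Longrightarrow> H = carrier G"
    and P: "definable L M n P" "P \<subseteq> carrier G" and Q: "definable L M n Q" "Q \<subseteq> carrier G"
    and nP: "\<not> negligible P" and nQ: "\<not> negligible Q"
  shows "negligible (null_factors P Q)"
proof (rule ccontr)
  define T where "T = null_factors P Q"
  assume "\<not> negligible (null_factors P Q)"
  then obtain c where c: "c > 0" "\<forall>\<^sub>F N in U. real (card (slice n T N)) \<ge> c * slice_order N"
    unfolding not_negligible_iff T_def by blast
  obtain c1 where c1: "c1 > 0" "\<forall>\<^sub>F N in U. real (card (slice n P N)) \<ge> c1 * slice_order N"
    using nP unfolding not_negligible_iff by blast
  obtain c2 where c2: "c2 > 0" "\<forall>\<^sub>F N in U. real (card (slice n Q N)) \<ge> c2 * slice_order N"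
    using nQ unfolding not_negligible_iff by blast
  have T: "definable L M n T" "T \<subseteq> carrier G"
    using definable_null_factors[OF DC P Q] unfolding T_def null_factors_def by auto
  have "null_stabilizer T = carrier G"
    using connected subgroup_null_stabilizer[OF T] definable_null_stabilizer[OF DC T]
      null_stabilizer_finite_index[OF DC P Q] unfolding T_def by blast
  then have null: "negligible (shift_diff G T h)" if "h \<in> carrier G" for h
    using that unfolding null_stabilizer_def by blast
  \<comment> \<open>Chosen so that the two error terms below, \<eta>/c from the complement of T and
    \<eta> from T itself, add up to half of c1 c2.\<close>
  define \<eta> where "\<eta> = c1 * c2 / (2 * (1 + 1 / c))"
  have \<eta>: "\<eta> > 0" "\<eta> * (1 + 1 / c) = c1 * c2 / 2"
  proof -
    define d where "d = 1 + 1 / c"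
    have d: "d > 0" using c(1) unfolding d_def by (simp add: add_pos_pos)
    then show "\<eta> > 0" using c1(1) c2(1) unfolding \<eta>_def d_def[symmetric] by simp
    show "\<eta> * (1 + 1 / c) = c1 * c2 / 2"
      using d unfolding \<eta>_def d_def[symmetric] by (simp add: field_simps)
  qed
  have shift: "\<forall>\<^sub>F N in U. \<forall>h\<in>slice n (carrier G) N.
      real (card (shift_diff (slice_group N) (slice n T N) h)) \<le> \<eta> * slice_order N"
  proof (rule transfer_slice[OF definable_carrier])
    fix h assume "h \<in> carrier G"
    then show "\<forall>\<^sub>F N in U. real (card (shift_diff (slice_group N) (slice n T N) (coord N h)))
        \<le> \<eta> * slice_order N"
      using null negligible_shift_diff_iff(1)[OF T] \<eta>(1) by blast
  qed
  have small: "\<forall>\<^sub>F N in U. \<forall>g\<in>slice n T N.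
      real (card (factor_set (slice_group N) (slice n P N) (slice n Q N) g)) \<le> \<eta> * slice_order N"
  proof (rule transfer_slice[OF T(1)])
    fix g assume "g \<in> T"
    then have "g \<in> carrier G" "negligible (factor_set G P Q g)"
      unfolding T_def null_factors_def by auto
    then show "\<forall>\<^sub>F N in U. real (card (factor_set (slice_group N) (slice n P N) (slice n Q N) (coord N g)))
        \<le> \<eta> * slice_order N"
      using negligible_factor_set_iff(1)[OF P Q] \<eta>(1) by blast
  qed
  from c(2) c1(2) c2(2) shift small group_slice_group finite_carrier_slice
    eventually_slice_subset_carrier[OF T] eventually_slice_subset_carrier[OF P]
    eventually_slice_subset_carrier[OF Q]
  have "\<forall>\<^sub>F N in U. False"
  proof eventually_elim
    case (elim N)
    interpret S: group "slice_group N" by fact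
    let ?G = "slice n (carrier G) N" and ?T = "slice n T N" and ?P = "slice n P N" and ?Q = "slice n Q N"
    let ?f = "factor_set (slice_group N) ?P ?Q"
    have fin: "finite ?G" and pos: "slice_order N > 0" using elim(7) by simp_all
    have order: "real (card ?G) = slice_order N" unfolding slice_order_def by simp
    have sub: "?T \<subseteq> ?G" "?P \<subseteq> ?G" "?Q \<subseteq> ?G" using elim(8-10) by simp_all
    \<comment> \<open>The sum of |T - hT| over all h: since T has at least c |G| points, its
      complement has at most (\<eta>/c) |G|.\<close>
    have "real (card ?T) * real (card (?G - ?T)) = (\<Sum>h\<in>?G. real (card (shift_diff (slice_group N) ?T h)))"
      using S.sum_card_shift_diff[of ?T] fin sub(1) by (simp flip: of_nat_sum of_nat_mult)
    also have "\<dots> \<le> slice_order N * (\<eta> * slice_order N)"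
      using sum_bounded_above[of ?G "\<lambda>h. real (card (shift_diff (slice_group N) ?T h))" "\<eta> * slice_order N"]
        elim(4) order by simp
    finally have "c * slice_order N * real (card (?G - ?T)) \<le> slice_order N * (\<eta> * slice_order N)"
      using mult_right_mono[OF elim(1), of "real (card (?G - ?T))"] by simp
    then have "slice_order N * (c * real (card (?G - ?T))) \<le> slice_order N * (\<eta> * slice_order N)"
      by (simp add: mult_ac)
    then have "c * real (card (?G - ?T)) \<le> \<eta> * slice_order N" using pos by simp
    then have comp: "real (card (?G - ?T)) \<le> (\<eta> / c) * slice_order N"
      using c(1) by (simp add: field_simps)
    \<comment> \<open>The pairs in P \<times> Q are sorted by their product g. There are at most |G|
      of them for g off T, where g itself is rare, and at most \<eta> |G| for g in T.\<close>
    have "c1 * slice_order N * (c2 * slice_order N) \<le> real (card ?P) * real (card ?Q)"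
      using elim(2,3) c1(1) c2(1) pos by (intro mult_mono) auto
    also have "\<dots> = (\<Sum>g\<in>?G. real (card (?f g)))"
      using S.sum_card_factor_set[of ?P ?Q] fin sub by (simp flip: of_nat_sum of_nat_mult)
    also have "\<dots> = (\<Sum>g\<in>?G - ?T. real (card (?f g))) + (\<Sum>g\<in>?T. real (card (?f g)))"
      using sum.subset_diff[OF sub(1) fin] by simp
    also have "\<dots> \<le> real (card (?G - ?T)) * slice_order N + real (card ?T) * (\<eta> * slice_order N)"
    proof (rule add_mono)
      have "real (card (?f g)) \<le> slice_order N" for g
        unfolding order[symmetric] using fin sub(2)
        by (intro of_nat_mono card_mono) (auto simp: factor_set_def)
      then show "(\<Sum>g\<in>?G - ?T. real (card (?f g))) \<le> real (card (?G - ?T)) * slice_order N"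
        by (intro sum_bounded_above)
      show "(\<Sum>g\<in>?T. real (card (?f g))) \<le> real (card ?T) * (\<eta> * slice_order N)"
        using elim(5) by (intro sum_bounded_above) auto
    qed
    also have "\<dots> \<le> (\<eta> / c) * slice_order N * slice_order N + slice_order N * (\<eta> * slice_order N)"
    proof (intro add_mono mult_right_mono comp)
      show "real (card ?T) \<le> slice_order N"
        unfolding order[symmetric] using fin sub(1) by (intro of_nat_mono card_mono)
    qed (use \<eta>(1) pos in auto)
    also have "\<dots> = (\<eta> * (1 + 1 / c)) * (slice_order N * slice_order N)"
      by (simp add: algebra_simps)
    finally have "(c1 * c2) * (slice_order N * slice_order N) \<le> (c1 * c2 / 2) * (slice_order N * slice_order N)"
      unfolding \<eta>(2) by (simp add: mult_ac)
    then have "c1 * c2 \<le> c1 * c2 / 2"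
      by (rule mult_right_le_imp_le[OF _ mult_pos_pos[OF pos pos]])
    then show ?case using mult_pos_pos[OF c1(1) c2(1)] by linarith
  qed
  then show False using not_eventually_False by simp
qed

section \<open>Products of sets that are not negligible\<close>

lemma negligible_subset:
  assumes "definable L M n X" "definable L M n Y" "X \<subseteq> Y" "negligible Y"
  shows "negligible X"
  unfolding negligible_def
proof (intro allI impI)
  fix \<epsilon> :: real assume "\<epsilon> > 0"
  then have "\<forall>\<^sub>F N in U. real (card (slice n Y N)) \<le> \<epsilon> * slice_order N"
    using assms(4) unfolding negligible_def by blast
  with slice_card_mono[OF assms(1-3)]
  show "\<forall>\<^sub>F N in U. real (card (slice n X N)) \<le> \<epsilon> * slice_order N"
    by eventually_elim linarith
qed

lemma factor_set_empty_iff: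
  assumes "P \<subseteq> carrier G" "Q \<subseteq> carrier G" "g \<in> carrier G"
  shows "factor_set G P Q g = {} \<longleftrightarrow> g \<notin> P <#> Q"
proof -
  have "g \<in> P <#> Q \<longleftrightarrow> (\<exists>x\<in>P. inv x \<otimes> g \<in> Q)"
  proof
    assume "g \<in> P <#> Q"
    then obtain x y where xy: "x \<in> P" "y \<in> Q" "g = x \<otimes> y" unfolding set_mult_def by auto
    then have "inv x \<otimes> g = y" using assms by (simp add: inv_mult_cancel1 subset_iff)
    then show "\<exists>x\<in>P. inv x \<otimes> g \<in> Q" using xy(1,2) by (intro bexI[of _ x]) simp_all
  next
    assume "\<exists>x\<in>P. inv x \<otimes> g \<in> Q"
    then obtain x where x: "x \<in> P" "inv x \<otimes> g \<in> Q" by auto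
    then have "x \<otimes> (inv x \<otimes> g) = g" using assms by (simp add: inv_mult_cancel2 subset_iff)
    then show "g \<in> P <#> Q" using x unfolding set_mult_def by force
  qed
  then show ?thesis unfolding factor_set_def by auto
qed

text \<open>An element of G is a product exactly when its factor set, a fibre of the factor
  relation, is nonempty; projecting the relation collects these elements.\<close>

lemma definable_set_mult:
  assumes P: "definable L M n P" "P \<subseteq> carrier G" and Q: "definable L M n Q" "Q \<subseteq> carrier G"
  shows "definable L M n (P <#> Q)"
proof -
  let ?Z = "{x @ z | x z. x \<in> P \<and> z \<in> nlists n (univ M) \<and> (\<exists>y\<in>Q. x @ y @ z \<in> graph)}"
  have "P <#> Q = carrier G \<inter> {z \<in> nlists n (univ M). \<exists>x\<in>nlists n (univ M). x @ z \<in> ?Z}"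
    (is "_ = _ \<inter> ?W")
  proof -
    have "g \<in> P <#> Q \<longleftrightarrow> g \<in> ?W" if g: "g \<in> carrier G" for g
    proof -
      have "g \<in> P <#> Q \<longleftrightarrow> {x \<in> nlists n (univ M). x @ g \<in> ?Z} \<noteq> {}"
        unfolding fibre_factor_set[OF P(2) Q(2) g] factor_set_empty_iff[OF P(2) Q(2) g] by simp
      also have "\<dots> \<longleftrightarrow> (\<exists>x\<in>nlists n (univ M). x @ g \<in> ?Z)"
        unfolding Collect_empty_eq Bex_def by (rule not_all[THEN trans]) (simp only: not_not)
      finally show ?thesis using carrier_subset[OF g] by (simp only: mem_Collect_eq simp_thms)
    qed
    moreover have "P <#> Q \<subseteq> carrier G" using P(2) Q(2) by (rule set_mult_closed)
    ultimately show ?thesis by (intro Set.set_eqI) (simp only: Int_iff, blast)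
  qed
  then show ?thesis
    using definable_Int[OF definable_carrier
        definable_projection[OF definable_factor_relation(1)[OF definable_graph P(1) Q(1)]]] by simp
qed

lemma negligible_Diff_set_mult:
  assumes DC: "dimension_comparison L \<C> U"
    and connected: "\<And>H. subgroup H G \<Longrightarrow> definable L M n H \<Longrightarrow> finite (rcosets H) \<Longrightarrow> H = carrier G"
    and P: "definable L M n P" "P \<subseteq> carrier G" and Q: "definable L M n Q" "Q \<subseteq> carrier G"
    and "\<not> negligible P" "\<not> negligible Q"
  shows "negligible (carrier G - (P <#> Q))"
proof (rule negligible_subset)
  show "definable L M n (carrier G - (P <#> Q))"
    by (rule definable_Diff[OF definable_carrier definable_set_mult[OF P Q]])
  show "definable L M n (null_factors P Q)" by (rule definable_null_factors[OF DC P Q])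
  show "negligible (null_factors P Q)" by (rule negligible_null_factors) fact+
  show "carrier G - (P <#> Q) \<subseteq> null_factors P Q"
  proof
    fix g assume g: "g \<in> carrier G - (P <#> Q)"
    then have empty: "factor_set G P Q g = {}" using factor_set_empty_iff[OF P(2) Q(2)] by blast
    have "definable L M n (factor_set G P Q g)" using definable_factor_set[OF P Q] g by blast
    then have "\<forall>\<^sub>F N in U. slice n (factor_set G P Q g) N = {}" using slice_empty empty by simp
    with finite_carrier_slice have "\<forall>\<^sub>F N in U. real (card (slice n (factor_set G P Q g) N)) \<le> \<epsilon> * slice_order N"
      if "\<epsilon> > 0" for \<epsilon> by eventually_elim (use that in simp)
    then show "g \<in> null_factors P Q" using g unfolding null_factors_def negligible_def by simp
  qed
qed

text \<open>If g is missed, then g x^-1 lies in the complement of Y for every x in X. In almost all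
  slice groups this is an injection, so X would be no larger than a null set.\<close>

lemma set_mult_eq_carrier:
  assumes Y: "definable L M n Y" "Y \<subseteq> carrier G" and X: "definable L M n X" "X \<subseteq> carrier G"
    and "negligible (carrier G - Y)" "\<not> negligible X"
  shows "Y <#> X = carrier G"
proof (rule ccontr)
  assume "Y <#> X \<noteq> carrier G"
  moreover have "Y <#> X \<subseteq> carrier G" using Y(2) X(2) by (rule set_mult_closed)
  ultimately obtain g where g: "g \<in> carrier G" "g \<notin> Y <#> X" by blast
  let ?D = "carrier G - Y"
  have D: "definable L M n ?D" by (rule definable_Diff[OF definable_carrier Y(1)])
  have out: "g \<otimes> inv x \<in> ?D" if x: "x \<in> X" for x
  proof -
    have xG: "x \<in> carrier G" using x X by blast
    have "(g \<otimes> inv x) \<otimes> x = g" using xG g by (simp add: m_assoc)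
    then have "g \<otimes> inv x \<notin> Y" using g x unfolding set_mult_def by force
    then show ?thesis using xG g by simp
  qed
  have "\<forall>\<^sub>F N in U. \<forall>x\<in>slice n X N.
      coord N g \<otimes>\<^bsub>slice_group N\<^esub> inv\<^bsub>slice_group N\<^esub> x \<in> slice n ?D N"
  proof (rule transfer_slice[OF X(1)])
    fix x assume x: "x \<in> X"
    then have xG: "x \<in> carrier G" using X by blast
    show "\<forall>\<^sub>F N in U. coord N g \<otimes>\<^bsub>slice_group N\<^esub> inv\<^bsub>slice_group N\<^esub> (coord N x) \<in> slice n ?D N"
      using coord_inv[OF xG] coord_mult[OF g(1) inv_closed[OF xG]] coord_in_slice[OF D out[OF x]]
      by eventually_elim simp
  qed
  with eventually_in_class group_slice_group coord_in_slice[OF definable_carrier g(1)]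
    eventually_slice_subset_carrier[OF X]
  have card: "\<forall>\<^sub>F N in U. card (slice n X N) \<le> card (slice n ?D N)"
  proof eventually_elim
    case (elim N)
    interpret S: group "slice_group N" by fact
    show ?case
    proof (rule card_inj_on_le[of "\<lambda>x. coord N g \<otimes>\<^bsub>slice_group N\<^esub> inv\<^bsub>slice_group N\<^esub> x"])
      show "inj_on (\<lambda>x. coord N g \<otimes>\<^bsub>slice_group N\<^esub> inv\<^bsub>slice_group N\<^esub> x) (slice n X N)"
      proof (rule inj_onI)
        fix x y assume xy: "x \<in> slice n X N" "y \<in> slice n X N"
          "coord N g \<otimes>\<^bsub>slice_group N\<^esub> inv\<^bsub>slice_group N\<^esub> x = coord N g \<otimes>\<^bsub>slice_group N\<^esub> inv\<^bsub>slice_group N\<^esub> y"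
        then have mem: "x \<in> carrier (slice_group N)" "y \<in> carrier (slice_group N)"
          "coord N g \<in> carrier (slice_group N)" using elim(3,4) by auto
        then have "inv\<^bsub>slice_group N\<^esub> x = inv\<^bsub>slice_group N\<^esub> y"
          using xy(3) S.inv_mult_cancel1 S.inv_closed by metis
        then show "x = y" using S.inv_inv mem by metis
      qed
      show "finite (slice n ?D N)" by (rule finite_slice[OF D elim(1)])
    qed (use elim(5) in blast)
  qed
  have "negligible X" unfolding negligible_def
  proof (intro allI impI)
    fix \<epsilon> :: real assume "\<epsilon> > 0"
    then have "\<forall>\<^sub>F N in U. real (card (slice n ?D N)) \<le> \<epsilon> * slice_order N"
      using assms(5) unfolding negligible_def by blast
    with card show "\<forall>\<^sub>F N in U. real (card (slice n X N)) \<le> \<epsilon> * slice_order N"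
      by eventually_elim linarith
  qed
  then show False using assms(6) by simp
qed

end

theorem theorem6p1:
  fixes L :: "('f, 'p) language"
    and \<C> :: "('f, 'p, 'a) struct set"
    and U :: "('f, 'p, 'a) struct filter"
    and M :: "('f, 'p, ('f, 'p, 'a) ultra_elem set) struct"
    and n :: nat
    and G :: "('f, 'p, 'a) ultra_elem set list monoid"
    and X\<^sub>1 X\<^sub>2 X\<^sub>3 :: "('f, 'p, 'a) ultra_elem set list set"
    and \<delta>\<^sub>0 :: "('f, 'p, 'a) struct hcut"
  assumes "countable_language L"
    and "infinite \<C>"
    and "\<And>N. N \<in> \<C> \<Longrightarrow> is_structure L N \<and> finite (univ N)"
    and "nonprincipal_ultrafilter_on \<C> U"
    and "M = ultraproduct \<C> U"
    and "strong_attainability L \<C> U"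
    and "dimension_comparison L \<C> U"
    and "definable_group L M n G"
    and "\<And>H. subgroup H G \<Longrightarrow> definable L M n H \<Longrightarrow> finite (rcosets\<^bsub>G\<^esub> H) \<Longrightarrow> H = carrier G"
    and "definable L M n X\<^sub>1" "definable L M n X\<^sub>2" "definable L M n X\<^sub>3"
    and "X\<^sub>1 \<subseteq> carrier G" "X\<^sub>2 \<subseteq> carrier G" "X\<^sub>3 \<subseteq> carrier G"
    and "\<delta> L \<C> U (carrier G) = \<delta>\<^sub>0"
    and "\<delta> L \<C> U X\<^sub>1 = \<delta>\<^sub>0" "\<delta> L \<C> U X\<^sub>2 = \<delta>\<^sub>0" "\<delta> L \<C> U X\<^sub>3 = \<delta>\<^sub>0"
  shows "X\<^sub>1 <#>\<^bsub>G\<^esub> X\<^sub>2 <#>\<^bsub>G\<^esub> X\<^sub>3 = carrier G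
    \<and> \<delta> L \<C> U (carrier G - (X\<^sub>1 <#>\<^bsub>G\<^esub> X\<^sub>2)) < \<delta>\<^sub>0"
proof -
  note M = assms(5)
  interpret finite_ultraproduct L \<C> U
    using assms(3,4) by unfold_locales auto
  have "group G" using assms(8) unfolding definable_group_def by blast
  then interpret G: group G .
  interpret ultraproduct_group L \<C> U G n
    using assms(8) unfolding M by unfold_locales
  note X = assms(10-15)[unfolded M]
  have not_null: "\<not> negligible X\<^sub>1" "\<not> negligible X\<^sub>2" "\<not> negligible X\<^sub>3"
    using \<delta>_carrier_le_iff X(1-3) assms(16-19) by blast+
  let ?Y = "X\<^sub>1 <#>\<^bsub>G\<^esub> X\<^sub>2"
  have Y: "definable L (ultraproduct \<C> U) n ?Y" "?Y \<subseteq> carrier G"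
    using definable_set_mult[OF X(1,4,2,5)] G.set_mult_closed[OF X(4,5)] by simp_all
  have null: "negligible (carrier G - ?Y)"
    by (rule negligible_Diff_set_mult[OF assms(7) assms(9)[unfolded M] X(1,4,2,5) not_null(1,2)])
  have D: "definable L (ultraproduct \<C> U) n (carrier G - ?Y)"
    by (rule definable_Diff[OF definable_carrier Y(1)])
  have "\<delta> L \<C> U (carrier G - ?Y) \<le> \<delta> L \<C> U (carrier G)"
    using slice_card_mono[OF D definable_carrier] unfolding \<delta>_le_iff[OF D definable_carrier]
    by (intro exI[of _ 1]) simp
  \<comment> \<open>Cuts are ordered by inclusion; ruling out the reverse inclusion makes the one
    just shown strict.\<close>
  moreover have "\<not> \<delta> L \<C> U (carrier G) \<le> \<delta> L \<C> U (carrier G - ?Y)"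
    using \<delta>_carrier_le_iff[OF D] null by blast
  ultimately have "\<delta> L \<C> U (carrier G - ?Y) < \<delta>\<^sub>0" using assms(16) by (auto simp: less_le_not_le)
  moreover have "?Y <#>\<^bsub>G\<^esub> X\<^sub>3 = carrier G"
    by (rule set_mult_eq_carrier[OF Y X(3,6) null not_null(3)])
  ultimately show ?thesis by blast
qed

end
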